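(* Let $q,r\in\mathbb R^4$ and let $\Omega,\Xi\subset\mathbb H\cong\mathbb R^4$ be two conformally equivalent domains, with $T(\Xi)=\Omega$ for a Möbius transformation $T(x)=(ax+b)(cx+d)^{-1}$. Write $C_T=C^0+C^1e_1+C^2e_2+C^3e_3$ with $C^n$ real-valued on $\Xi$. Then $(f_0,f_1,f_2,f_3)\in CB^{\delta_{T,r}}_{\gamma_{T,r,q}}(\Omega)$ if and only if $(g_0,g_1,g_2,g_3)\in CB^q_{\rho_T}(\Xi)$, where for $x\in\Xi$, with $y=T(x)$, $$g_0(x)=e^{\langle r-q,x\rangle}\left[C^0(x)f_0(y)-C^1(x)f_1(y)-C^2(x)f_2(y)-C^3(x)f_3(y)\right],$$ $$g_1(x)=e^{\langle r-q,x\rangle}\left[C^1(x)f_0(y)+C^0(x)f_1(y)-C^3(x)f_2(y)+C^2(x)f_3(y)\right],$$ $$g_2(x)=e^{\langle r-q,x\rangle}\left[C^2(x)f_0(y)-C^1(x)f_3(y)+C^3(x)f_1(y)+C^0(x)f_2(y)\right],$$ $$g_3(x)=e^{\langle r-q,x\rangle}\left[C^3(x)f_0(y)-C^2(x)f_1(y)+C^1(x)f_2(y)+C^0(x)f_3(y)\right].$$ Moreover, the mapping $(f_0,f_1,f_2,f_3)\mapsto(g_0,g_1,g_2,g_3)$ is a bijective real-linear operator from $CB^{\delta_{T,r}}_{\gamma_{T,r,q}}(\Omega)$ to $CB^q_{\rho_T}(\Xi)$.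
   Context: $\mathbb H$ denotes the quaternions with units $e_1,e_2,e_3$, $e_1e_2=e_3$, $e_2e_3=e_1$, $e_3e_1=e_2$, $e_k^2=-1$. Points $x\in\mathbb R^4$ and parameters $q,r\in\mathbb R^4$ are identified with quaternions through $\psi=\{1,e_1,-e_2,e_3\}$: $x\leftrightarrow x_0+x_1e_1-x_2e_2+x_3e_3$, likewise $q,r$; $\langle q,x\rangle=\sum_kq_kx_k$; $\mu$ is Lebesgue measure. In the formulas for $T,\delta_{T,r},\rho_T,C_T$ the symbols $x,y,r$ denote these quaternions. Systems. For a function $\delta=\delta^0+\delta^1e_1-\delta^2e_2+\delta^3e_3$ (with $\delta^n$ real-valued), the inhomogeneous Cimmino system with coefficient $\delta$ for real-valued $C^1$ functions $(f_0,f_1,f_2,f_3)$ is $$\begin{cases} \dfrac{\partial f_0}{\partial x_0}+\dfrac{\partial f_2}{\partial x_2}-\dfrac{\partial f_1}{\partial x_1}-\dfrac{\partial f_3}{\partial x_3}=-(\delta^0f_0+\delta^2f_2-\delta^1f_1-\delta^3f_3)\\[2mm] \dfrac{\partial f_0}{\partial x_1}+\dfrac{\partial f_1}{\partial x_0}-\dfrac{\partial f_2}{\partial x_3}-\dfrac{\partial f_3}{\partial x_2}=-(\delta^1f_0+\delta^0f_1-\delta^3f_2-\delta^2f_3)\\[2mm] \dfrac{\partial f_0}{\partial x_2}+\dfrac{\partial f_3}{\partial x_1}-\dfrac{\partial f_1}{\partial x_3}-\dfrac{\partial f_2}{\partial x_0}=-(\delta^2f_0+\delta^1f_3-\delta^3f_1-\delta^0f_2)\\[2mm]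 \dfrac{\partial f_0}{\partial x_3}+\dfrac{\partial f_1}{\partial x_2}+\dfrac{\partial f_2}{\partial x_1}+\dfrac{\partial f_3}{\partial x_0}=-(\delta^3f_0+\delta^2f_1+\delta^1f_2+\delta^0f_3), \end{cases}$$ i.e. ${}^\psi\mathcal D[f]+\delta f=0$ with $f=f_0+f_1e_1+f_2e_2+f_3e_3$ and ${}^\psi\mathcal D=\frac{\partial}{\partial x_0}+e_1\frac{\partial}{\partial x_1}-e_2\frac{\partial}{\partial x_2}+e_3\frac{\partial}{\partial x_3}$. For constants $\delta^n=q_n$ it is called the system with parameter $q$. Möbius data. $T(x)=(ax+b)(cx+d)^{-1}$, $a,b,c,d\in\mathbb H$, with $a\neq0$ (and $d\ne0$) if $c=0$, and $V:=b-ac^{-1}d\ne0$ if $c\ne0$; $T$ is finite on $\Xi$ and maps it bijectively onto $\Omega$. For $y\in\Omega$: $\delta_{T,r}(y)=(\bar a)^{-1}r\bar d$ if $c=0$, and $\delta_{T,r}(y)=-\dfrac{(y-ac^{-1})\,c\,r\,\overline V\,(y-ac^{-1})}{|c|^2|y-ac^{-1}|^4}$ if $c\neq0$; $\gamma_{T,r,q}(y)=e^{2\langle r-q,T^{-1}(y)\rangle}$. For $x\in\Xi$: $\rho_T(x)=1$ if $c=0$ and $\rho_T(x)=|cxV^{-1}+dV^{-1}|^{-2}$ if $c\neq0$; and $$C_T(x)=\begin{cases}\dfrac{|a|^2}{|d|}d^{-1},&c=0,\\[2mm]\dfrac{|c|^2}{|V|}V^{-1}\dfrac{\overline{cxV^{-1}+dV^{-1}}}{|cxV^{-1}+dV^{-1}|^4},&c\neq0.\end{cases}$$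 Spaces. - $CB^{\delta_{T,r}}_{\gamma_{T,r,q}}(\Omega)$: four-tuples of functions in $C^1(\Omega,\mathbb R)$ solving on $\Omega$ the system with coefficient $\delta_{T,r}$ and with $\int_\Omega|f_k|^2\gamma_{T,r,q}d\mu<\infty$, $k=0,1,2,3$. - $CB^q_{\rho_T}(\Xi)$: four-tuples of functions in $C^1(\Xi,\mathbb R)$ solving on $\Xi$ the system with parameter $q$ and with $\int_\Xi|f_k|^2\rho_Td\mu<\infty$, $k=0,1,2,3$. *)

theory Defs
  imports "HOL-Analysis.Analysis"
begin

section \<open>Quaternions\<close>

text \<open>\<open>Quat w x y z\<close> is $w + x e_1 + y e_2 + z e_3$ with $e_1 e_2 = e_3$, $e_2 e_3 = e_1$,
  $e_3 e_1 = e_2$ and $e_k^2 = -1$.\<close>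

datatype quat = Quat (qRe: real) (qI1: real) (qI2: real) (qI3: real)

lemma quat_eq_iff:
  "p = q \<longleftrightarrow> qRe p = qRe q \<and> qI1 p = qI1 q \<and> qI2 p = qI2 q \<and> qI3 p = qI3 q"
  by (cases p; cases q) auto

instantiation quat :: real_inner
begin

definition zero_quat :: quat where "0 = Quat 0 0 0 0"

definition plus_quat :: "quat \<Rightarrow> quat \<Rightarrow> quat" where
  "p + q = Quat (qRe p + qRe q) (qI1 p + qI1 q) (qI2 p + qI2 q) (qI3 p + qI3 q)"

definition uminus_quat :: "quat \<Rightarrow> quat" where
  "- p = Quat (- qRe p) (- qI1 p) (- qI2 p) (- qI3 p)"

definition minus_quat :: "quat \<Rightarrow> quat \<Rightarrow> quat" where
  "p - q = Quat (qRe p - qRe q) (qI1 p - qI1 q) (qI2 p - qI2 q) (qI3 p - qI3 q)"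

definition scaleR_quat :: "real \<Rightarrow> quat \<Rightarrow> quat" where
  "scaleR t p = Quat (t * qRe p) (t * qI1 p) (t * qI2 p) (t * qI3 p)"

definition inner_quat :: "quat \<Rightarrow> quat \<Rightarrow> real" where
  "inner p q = qRe p * qRe q + qI1 p * qI1 q + qI2 p * qI2 q + qI3 p * qI3 q"

definition norm_quat :: "quat \<Rightarrow> real" where
  "norm p = sqrt ((qRe p)\<^sup>2 + (qI1 p)\<^sup>2 + (qI2 p)\<^sup>2 + (qI3 p)\<^sup>2)"

definition sgn_quat :: "quat \<Rightarrow> quat" where
  "sgn (p :: quat) = scaleR (inverse (norm p)) p"

definition dist_quat :: "quat \<Rightarrow> quat \<Rightarrow> real" where
  "dist (p :: quat) q = norm (p - q)"

definition uniformity_quat :: "(quat \<times> quat) filter" where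
  "uniformity = (INF e\<in>{0<..}. principal {(x :: quat, y). dist x y < e})"

definition open_quat :: "quat set \<Rightarrow> bool" where
  "open (U :: quat set) \<longleftrightarrow> (\<forall>x\<in>U. \<forall>\<^sub>F (x', y) in uniformity. x' = x \<longrightarrow> y \<in> U)"

instance
proof
  fix x y z :: quat and r s :: real
  show "x + y + z = x + (y + z)" "x + y = y + x" "0 + x = x" "- x + x = 0" "x - y = x + - y"
    by (simp_all add: plus_quat_def zero_quat_def uminus_quat_def minus_quat_def quat_eq_iff)
  show "r *\<^sub>R (x + y) = r *\<^sub>R x + r *\<^sub>R y" "(r + s) *\<^sub>R x = r *\<^sub>R x + s *\<^sub>R x"
    "r *\<^sub>R s *\<^sub>R x = (r * s) *\<^sub>R x" "1 *\<^sub>R x = x"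
    by (simp_all add: plus_quat_def scaleR_quat_def quat_eq_iff algebra_simps)
  show "inner x y = inner y x" "inner (x + y) z = inner x z + inner y z"
    "inner (r *\<^sub>R x) y = r * inner x y"
    by (simp_all add: inner_quat_def plus_quat_def scaleR_quat_def algebra_simps)
  show "0 \<le> inner x x"
    by (simp add: inner_quat_def)
  have "a*a + b*b + c*c + d*d = 0 \<longleftrightarrow> a = 0 \<and> b = 0 \<and> c = 0 \<and> d = 0" for a b c d :: real
    by (smt (verit) mult_eq_0_iff zero_le_square)
  then show "inner x x = 0 \<longleftrightarrow> x = 0"
    by (simp add: inner_quat_def zero_quat_def quat_eq_iff)
  show "norm x = sqrt (inner x x)"
    by (simp add: norm_quat_def inner_quat_def power2_eq_square)
qed (rule sgn_quat_def dist_quat_def uniformity_quat_def open_quat_def)+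

end

instantiation quat :: real_normed_div_algebra
begin

definition one_quat :: quat where "1 = Quat 1 0 0 0"

definition times_quat :: "quat \<Rightarrow> quat \<Rightarrow> quat" where
  "p * q = Quat
     (qRe p * qRe q - qI1 p * qI1 q - qI2 p * qI2 q - qI3 p * qI3 q)
     (qRe p * qI1 q + qI1 p * qRe q + qI2 p * qI3 q - qI3 p * qI2 q)
     (qRe p * qI2 q - qI1 p * qI3 q + qI2 p * qRe q + qI3 p * qI1 q)
     (qRe p * qI3 q + qI1 p * qI2 q - qI2 p * qI1 q + qI3 p * qRe q)"

definition inverse_quat :: "quat \<Rightarrow> quat" where
  "inverse p = (1 / (norm p)\<^sup>2) *\<^sub>R Quat (qRe p) (- qI1 p) (- qI2 p) (- qI3 p)"

definition divide_quat :: "quat \<Rightarrow> quat \<Rightarrow> quat" where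
  "(p :: quat) div q = p * inverse q"

instance
proof
  fix x y z :: quat and r :: real
  show "x * y * z = x * (y * z)" "(x + y) * z = x * z + y * z" "x * (y + z) = x * y + x * z"
    "r *\<^sub>R x * y = r *\<^sub>R (x * y)" "x * r *\<^sub>R y = r *\<^sub>R (x * y)"
    by (simp_all add: times_quat_def plus_quat_def scaleR_quat_def quat_eq_iff algebra_simps)
  show "1 * x = x" "x * 1 = x" "(0::quat) \<noteq> 1"
    by (simp_all add: times_quat_def one_quat_def zero_quat_def quat_eq_iff)
  show "x div y = x * inverse y"
    by (rule divide_quat_def)
  show "inverse (0::quat) = 0"
    by (simp add: inverse_quat_def zero_quat_def scaleR_quat_def)
  have n2: "(norm x)\<^sup>2 = (qRe x)\<^sup>2 + (qI1 x)\<^sup>2 + (qI2 x)\<^sup>2 + (qI3 x)\<^sup>2"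
    by (simp add: norm_quat_def)
  show "inverse x * x = 1" "x * inverse x = 1" if "x \<noteq> 0"
  proof -
    define N where "N = (norm x)\<^sup>2"
    have "N \<noteq> 0" using that by (simp add: N_def)
    moreover have "N = qRe x * qRe x + qI1 x * qI1 x + qI2 x * qI2 x + qI3 x * qI3 x"
      using n2 by (simp add: N_def power2_eq_square)
    ultimately show "inverse x * x = 1" "x * inverse x = 1"
      unfolding inverse_quat_def N_def[symmetric]
      by (simp_all add: times_quat_def one_quat_def scaleR_quat_def quat_eq_iff divide_simps)
  qed
  show "norm (x * y) = norm x * norm y"
    unfolding norm_quat_def real_sqrt_mult[symmetric]
    by (simp add: times_quat_def power2_eq_square algebra_simps)
qed

end

definition qcnj :: "quat \<Rightarrow> quat" where
  "qcnj p = Quat (qRe p) (- qI1 p) (- qI2 p) (- qI3 p)"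


section \<open>Points of $\mathbb R^4$ and the structural set $\psi = \{1, e_1, -e_2, e_3\}$\<close>

text \<open>Coordinates are indexed by the four-element type \<open>4\<close>, whose elements are
  \<open>0\<close>, \<open>1\<close>, \<open>2\<close>, \<open>3\<close>. Note the sign of the $e_2$-component.\<close>

definition psi :: "real ^ 4 \<Rightarrow> quat" where
  "psi x = Quat (x $ 0) (x $ 1) (- (x $ 2)) (x $ 3)"

definition psi_coord :: "4 \<Rightarrow> quat \<Rightarrow> real" where
  "psi_coord k p = (if k = 0 then qRe p else if k = 1 then qI1 p else if k = 2 then - qI2 p else qI3 p)"

definition psi_inv :: "quat \<Rightarrow> real ^ 4" where
  "psi_inv p = (\<chi> k. psi_coord k p)"

lemma psi_psi_inv: "psi (psi_inv p) = p"
  by (simp add: psi_def psi_inv_def psi_coord_def quat_eq_iff)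

lemma psi_inv_psi: "psi_inv (psi x) = x"
proof -
  have "k = 0 \<or> k = 1 \<or> k = 2 \<or> k = 3" for k :: 4
    using exhaust_4[of k] by auto
  then have "psi_inv (psi x) $ k = x $ k" for k
    by (auto simp: psi_def psi_inv_def psi_coord_def)
  then show ?thesis by (simp add: vec_eq_iff)
qed

definition domain4 :: "(real ^ 4) set \<Rightarrow> bool" where
  "domain4 S \<longleftrightarrow> open S \<and> connected S \<and> S \<noteq> {}"


section \<open>The inhomogeneous Cimmino system\<close>

definition partial_deriv :: "4 \<Rightarrow> (real ^ 4 \<Rightarrow> real) \<Rightarrow> real ^ 4 \<Rightarrow> real" where
  "partial_deriv k f x = frechet_derivative f (at x) (axis k 1)"

text \<open>Only used for open \<open>S\<close>.\<close>
definition C1_on :: "(real ^ 4) set \<Rightarrow> (real ^ 4 \<Rightarrow> real) \<Rightarrow> bool" where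
  "C1_on S f \<longleftrightarrow> (\<forall>x\<in>S. f differentiable (at x)) \<and> (\<forall>k. continuous_on S (partial_deriv k f))"

type_synonym fun4 =
  "(real ^ 4 \<Rightarrow> real) \<times> (real ^ 4 \<Rightarrow> real) \<times> (real ^ 4 \<Rightarrow> real) \<times> (real ^ 4 \<Rightarrow> real)"

text \<open>The coefficient is quaternion-valued; the real functions $\delta^n$ in the system are its
  coordinates with respect to $\psi$, so that $\delta^2$ is minus the $e_2$-component.\<close>

definition cimmino_system :: "(real ^ 4) set \<Rightarrow> (real ^ 4 \<Rightarrow> quat) \<Rightarrow> fun4 \<Rightarrow> bool" where
  "cimmino_system S \<delta> = (\<lambda>(f0, f1, f2, f3). \<forall>x\<in>S.
     (let d0 = psi_coord 0 (\<delta> x); d1 = psi_coord 1 (\<delta> x);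
          d2 = psi_coord 2 (\<delta> x); d3 = psi_coord 3 (\<delta> x) in
      partial_deriv 0 f0 x + partial_deriv 2 f2 x - partial_deriv 1 f1 x - partial_deriv 3 f3 x
        = - (d0 * f0 x + d2 * f2 x - d1 * f1 x - d3 * f3 x) \<and>
      partial_deriv 1 f0 x + partial_deriv 0 f1 x - partial_deriv 3 f2 x - partial_deriv 2 f3 x
        = - (d1 * f0 x + d0 * f1 x - d3 * f2 x - d2 * f3 x) \<and>
      partial_deriv 2 f0 x + partial_deriv 1 f3 x - partial_deriv 3 f1 x - partial_deriv 0 f2 x
        = - (d2 * f0 x + d1 * f3 x - d3 * f1 x - d0 * f2 x) \<and>
      partial_deriv 3 f0 x + partial_deriv 2 f1 x + partial_deriv 1 f2 x + partial_deriv 0 f3 x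
        = - (d3 * f0 x + d2 * f1 x + d1 * f2 x + d0 * f3 x)))"


section \<open>Function spaces\<close>

text \<open>Functions with domain \<open>S\<close> are represented extensionally (\<open>undefined\<close> outside \<open>S\<close>), so that
  equality of functions on \<open>S\<close> is equality in HOL.\<close>

definition four_tuples :: "(real ^ 4) set \<Rightarrow> fun4 set" where
  "four_tuples S = (S \<rightarrow>\<^sub>E UNIV) \<times> (S \<rightarrow>\<^sub>E UNIV) \<times> (S \<rightarrow>\<^sub>E UNIV) \<times> (S \<rightarrow>\<^sub>E UNIV)"

definition weighted_L2 :: "(real ^ 4) set \<Rightarrow> (real ^ 4 \<Rightarrow> real) \<Rightarrow> (real ^ 4 \<Rightarrow> real) \<Rightarrow> bool" where
  "weighted_L2 S w f \<longleftrightarrow> set_integrable lebesgue S (\<lambda>x. \<bar>f x\<bar>\<^sup>2 * w x)"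

definition CB :: "(real ^ 4) set \<Rightarrow> (real ^ 4 \<Rightarrow> quat) \<Rightarrow> (real ^ 4 \<Rightarrow> real) \<Rightarrow> fun4 set" where
  "CB S \<delta> w = {(f0, f1, f2, f3). (f0, f1, f2, f3) \<in> four_tuples S \<and>
     C1_on S f0 \<and> C1_on S f1 \<and> C1_on S f2 \<and> C1_on S f3 \<and>
     cimmino_system S \<delta> (f0, f1, f2, f3) \<and>
     weighted_L2 S w f0 \<and> weighted_L2 S w f1 \<and> weighted_L2 S w f2 \<and> weighted_L2 S w f3}"

definition zero4 :: "(real ^ 4) set \<Rightarrow> fun4" where
  "zero4 S = ((\<lambda>x\<in>S. 0), (\<lambda>x\<in>S. 0), (\<lambda>x\<in>S. 0), (\<lambda>x\<in>S. 0))"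

definition add4 :: "(real ^ 4) set \<Rightarrow> fun4 \<Rightarrow> fun4 \<Rightarrow> fun4" where
  "add4 S = (\<lambda>(f0, f1, f2, f3) (h0, h1, h2, h3).
     ((\<lambda>x\<in>S. f0 x + h0 x), (\<lambda>x\<in>S. f1 x + h1 x), (\<lambda>x\<in>S. f2 x + h2 x), (\<lambda>x\<in>S. f3 x + h3 x)))"

definition scale4 :: "(real ^ 4) set \<Rightarrow> real \<Rightarrow> fun4 \<Rightarrow> fun4" where
  "scale4 S t = (\<lambda>(f0, f1, f2, f3).
     ((\<lambda>x\<in>S. t * f0 x), (\<lambda>x\<in>S. t * f1 x), (\<lambda>x\<in>S. t * f2 x), (\<lambda>x\<in>S. t * f3 x)))"

definition real_function_space :: "(real ^ 4) set \<Rightarrow> fun4 set \<Rightarrow> bool" where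
  "real_function_space S X \<longleftrightarrow> X \<subseteq> four_tuples S \<and> zero4 S \<in> X \<and>
     (\<forall>f\<in>X. \<forall>h\<in>X. add4 S f h \<in> X) \<and> (\<forall>t. \<forall>f\<in>X. scale4 S t f \<in> X)"

definition real_linear_operator ::
  "(real ^ 4) set \<Rightarrow> fun4 set \<Rightarrow> (real ^ 4) set \<Rightarrow> fun4 set \<Rightarrow> (fun4 \<Rightarrow> fun4) \<Rightarrow> bool" where
  "real_linear_operator S X S' Y L \<longleftrightarrow>
     real_function_space S X \<and> real_function_space S' Y \<and> L \<in> X \<rightarrow> Y \<and>
     (\<forall>f\<in>X. \<forall>h\<in>X. L (add4 S f h) = add4 S' (L f) (L h)) \<and>
     (\<forall>t. \<forall>f\<in>X. L (scale4 S t f) = scale4 S' t (L f))"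


section \<open>Moebius data\<close>

definition moebius_V :: "quat \<Rightarrow> quat \<Rightarrow> quat \<Rightarrow> quat \<Rightarrow> quat" where
  "moebius_V a b c d = b - a * inverse c * d"

definition moebius_params :: "quat \<Rightarrow> quat \<Rightarrow> quat \<Rightarrow> quat \<Rightarrow> bool" where
  "moebius_params a b c d \<longleftrightarrow>
     (c = 0 \<longrightarrow> a \<noteq> 0 \<and> d \<noteq> 0) \<and> (c \<noteq> 0 \<longrightarrow> moebius_V a b c d \<noteq> 0)"

definition moebius :: "quat \<Rightarrow> quat \<Rightarrow> quat \<Rightarrow> quat \<Rightarrow> real ^ 4 \<Rightarrow> real ^ 4" where
  "moebius a b c d x = psi_inv ((a * psi x + b) * inverse (c * psi x + d))"

definition moebius_maps ::
  "quat \<Rightarrow> quat \<Rightarrow> quat \<Rightarrow> quat \<Rightarrow> (real ^ 4) set \<Rightarrow> (real ^ 4) set \<Rightarrow> bool" where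
  "moebius_maps a b c d \<Xi> \<Omega> \<longleftrightarrow> moebius_params a b c d \<and>
     (\<forall>x\<in>\<Xi>. c * psi x + d \<noteq> 0) \<and> bij_betw (moebius a b c d) \<Xi> \<Omega>"

definition delta_T ::
  "quat \<Rightarrow> quat \<Rightarrow> quat \<Rightarrow> quat \<Rightarrow> real ^ 4 \<Rightarrow> real ^ 4 \<Rightarrow> quat" where
  "delta_T a b c d r y =
     (if c = 0 then inverse (qcnj a) * psi r * qcnj d
      else (let z = psi y - a * inverse c in
        - ((z * c * psi r * qcnj (moebius_V a b c d) * z) /\<^sub>R ((norm c)\<^sup>2 * norm z ^ 4))))"

definition gamma_T ::
  "quat \<Rightarrow> quat \<Rightarrow> quat \<Rightarrow> quat \<Rightarrow> (real ^ 4) set \<Rightarrow> real ^ 4 \<Rightarrow> real ^ 4 \<Rightarrow> real ^ 4 \<Rightarrow> real" where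
  "gamma_T a b c d \<Xi> r q y = exp (2 * ((r - q) \<bullet> the_inv_into \<Xi> (moebius a b c d) y))"

definition rho_T :: "quat \<Rightarrow> quat \<Rightarrow> quat \<Rightarrow> quat \<Rightarrow> real ^ 4 \<Rightarrow> real" where
  "rho_T a b c d x =
     (if c = 0 then 1
      else (let V = moebius_V a b c d in
        1 / (norm (c * psi x * inverse V + d * inverse V))\<^sup>2))"

definition C_T :: "quat \<Rightarrow> quat \<Rightarrow> quat \<Rightarrow> quat \<Rightarrow> real ^ 4 \<Rightarrow> quat" where
  "C_T a b c d x =
     (if c = 0 then ((norm a)\<^sup>2 / norm d) *\<^sub>R inverse d
      else (let V = moebius_V a b c d; u = c * psi x * inverse V + d * inverse V in
        ((norm c)\<^sup>2 / norm V) *\<^sub>R (inverse V * (qcnj u /\<^sub>R norm u ^ 4))))"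

text \<open>Unlike the $\delta^n$, the real functions $C^n$ are the components with respect to the
  standard units $1, e_1, e_2, e_3$.\<close>

definition cimmino_operator ::
  "quat \<Rightarrow> quat \<Rightarrow> quat \<Rightarrow> quat \<Rightarrow> (real ^ 4) set \<Rightarrow> real ^ 4 \<Rightarrow> real ^ 4 \<Rightarrow> fun4 \<Rightarrow> fun4" where
  "cimmino_operator a b c d \<Xi> r q = (\<lambda>(f0, f1, f2, f3).
     let T = moebius a b c d;
         C0 = (\<lambda>x. qRe (C_T a b c d x)); C1 = (\<lambda>x. qI1 (C_T a b c d x));
         C2 = (\<lambda>x. qI2 (C_T a b c d x)); C3 = (\<lambda>x. qI3 (C_T a b c d x)) in
     ((\<lambda>x\<in>\<Xi>. exp ((r - q) \<bullet> x) *
         (C0 x * f0 (T x) - C1 x * f1 (T x) - C2 x * f2 (T x) - C3 x * f3 (T x))),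
      (\<lambda>x\<in>\<Xi>. exp ((r - q) \<bullet> x) *
         (C1 x * f0 (T x) + C0 x * f1 (T x) - C3 x * f2 (T x) + C2 x * f3 (T x))),
      (\<lambda>x\<in>\<Xi>. exp ((r - q) \<bullet> x) *
         (C2 x * f0 (T x) - C1 x * f3 (T x) + C3 x * f1 (T x) + C0 x * f2 (T x))),
      (\<lambda>x\<in>\<Xi>. exp ((r - q) \<bullet> x) *
         (C3 x * f0 (T x) - C2 x * f1 (T x) + C1 x * f2 (T x) + C0 x * f3 (T x)))))"

end

theory Submission
  imports Defs
begin

text \<open>
Read as a quaternion-valued function $F$, a four-tuple solves the inhomogeneous Cimmino system iff
$DF + \delta F = 0$, where $D = \sum_k \psi_k \partial_k$ is the Dirac operator of the structural set
(\<open>cimmino_system_iff_dirac\<close>), and it satisfies the four integrability conditions iff $|F|^2 w$ is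
integrable (\<open>CB_iff_dirac_solution\<close>). The operator of the theorem then reads
$G(x) = e^{\langle r-q, x\rangle}\, C_T(x)\, F(T(x))$ (\<open>cimmino_operator_eq\<close>).

For a quaternionic Moebius transformation both cases $c = 0$ and $c \neq 0$ have the derivative
$T'(x) v = p\, v\, s$ with $p = a - T(x)\, c$ and $s = (cx + d)^{-1}$: a similarity of ratio $|p|\,|s|$.
The theorem rests on four properties of $T$ and $C_T$.

  \<^item> $C_T$ is a real multiple of $s$. The Dirac operator does not depend on the choice of an
    orthonormal frame, so it may be computed in the rotated frame $p\, \psi_k\, s / (|p|\,|s|)$; a right factor
    $s$ in front of $F \circ T$ then turns $D(s_0\,(F \circ T))$, with $s_0$ frozen at its value $s(x)$, into
    $|s|^2\, \overline{p}\, (DF) \circ T$ (\<open>dirac_sandwich\<close>).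
  \<^item> $D C_T = 0$, because $C_T$ is constant or a Cauchy kernel composed with an affine map; so
    differentiating the factor $C_T$ contributes nothing.
  \<^item> Differentiating the exponential contributes $(r - q)\, G$, so $DG + qG$ is, up to an invertible left
    factor, $DF + \delta F$ at $T(x)$ with $\delta = p\, r\, s / (|p|\,|s|)^2$ (\<open>dirac_transform\<close>); this
    $\delta$ is $\delta_{T,r}(T(x))$ (\<open>delta_T_T\<close>).
  \<^item> The Jacobian determinant of $T$ is $(|p|\,|s|)^4 = |C_T|^2 \rho_T$ in absolute value, so the change of
    variables $y = T(x)$ takes $\int |F|^2 \gamma_{T,r,q}$ to $\int |G|^2 \rho_T$.

The operator is inverted explicitly through $T^{-1}$ and $C_T^{-1}$, both of class $C^1$, so the
equivalence for one tuple gives the bijection of the two spaces.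
\<close>

section \<open>Quaternions and points of four-space\<close>

lemma psi_simps [simp]:
  "qRe (psi x) = x $ 0" "qI1 (psi x) = x $ 1" "qI2 (psi x) = - (x $ 2)" "qI3 (psi x) = x $ 3"
  by (simp_all add: psi_def)

lemma quat_sel_simps [simp]:
  "qRe (p + q) = qRe p + qRe q" "qI1 (p + q) = qI1 p + qI1 q"
  "qI2 (p + q) = qI2 p + qI2 q" "qI3 (p + q) = qI3 p + qI3 q"
  "qRe (- p) = - qRe p" "qI1 (- p) = - qI1 p" "qI2 (- p) = - qI2 p" "qI3 (- p) = - qI3 p"
  "qRe (t *\<^sub>R p) = t * qRe p" "qI1 (t *\<^sub>R p) = t * qI1 p"
  "qI2 (t *\<^sub>R p) = t * qI2 p" "qI3 (t *\<^sub>R p) = t * qI3 p"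
  "qRe 0 = 0" "qI1 0 = 0" "qI2 0 = 0" "qI3 0 = 0"
  by (simp_all add: plus_quat_def uminus_quat_def scaleR_quat_def zero_quat_def)

lemma quat_mult_sel:
  "qRe (p * q) = qRe p * qRe q - qI1 p * qI1 q - qI2 p * qI2 q - qI3 p * qI3 q"
  "qI1 (p * q) = qRe p * qI1 q + qI1 p * qRe q + qI2 p * qI3 q - qI3 p * qI2 q"
  "qI2 (p * q) = qRe p * qI2 q - qI1 p * qI3 q + qI2 p * qRe q + qI3 p * qI1 q"
  "qI3 (p * q) = qRe p * qI3 q + qI1 p * qI2 q - qI2 p * qI1 q + qI3 p * qRe q"
  by (simp_all add: times_quat_def)

lemma quat_norm_sq: "(norm p)\<^sup>2 = (qRe p)\<^sup>2 + (qI1 p)\<^sup>2 + (qI2 p)\<^sup>2 + (qI3 p)\<^sup>2"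
  by (simp add: norm_quat_def)

lemma qcnj_eq_inverse: "qcnj p = (norm p)\<^sup>2 *\<^sub>R inverse p"
proof (cases "p = 0")
  case True
  then show ?thesis by (simp add: qcnj_def quat_eq_iff)
next
  case False
  then show ?thesis by (simp add: inverse_quat_def qcnj_def)
qed

text \<open>The index type has four elements with $4 = 0$, and the coordinates are counted from $0$.\<close>

lemma sum_univ_4: "sum f (UNIV :: 4 set) = f 0 + f 1 + f 2 + f 3"
proof -
  have "(4 :: 4) = 0" by simp
  then show ?thesis by (simp only: sum_4 add.commute add.left_commute)
qed

lemma norm_psi [simp]: "norm (psi x) = norm x"
  by (simp add: norm_quat_def norm_vec_def L2_set_def sum_univ_4)

lemma bounded_linear_psi: "bounded_linear psi"
  by (rule bounded_linear_intro[where K = 1]) (simp_all add: quat_eq_iff)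

lemmas linear_psi = bounded_linear.linear[OF bounded_linear_psi]

lemma norm_psi_inv [simp]: "norm (psi_inv p) = norm p"
  by (metis norm_psi psi_psi_inv)

lemma bounded_linear_psi_inv: "bounded_linear psi_inv"
proof (rule bounded_linear_intro[where K = 1])
  interpret psi: bounded_linear psi by (rule bounded_linear_psi)
  show "psi_inv (p + q) = psi_inv p + psi_inv q" for p q
    by (metis psi.add psi_inv_psi psi_psi_inv)
  show "psi_inv (t *\<^sub>R p) = t *\<^sub>R psi_inv p" for t p
    by (metis psi.scaleR psi_inv_psi psi_psi_inv)
qed simp

lemma inner_psi: "n \<bullet> psi v = psi_inv n \<bullet> v"
  by (simp add: inner_quat_def inner_vec_def sum_univ_4 psi_inv_def psi_coord_def)

lemma bounded_linear_quat_sel: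
  "bounded_linear qRe" "bounded_linear qI1" "bounded_linear qI2" "bounded_linear qI3"
  by (rule bounded_linear_intro[where K = 1];
      simp; simp add: norm_quat_def real_le_rsqrt)+

section \<open>Symbols of the Dirac operator and sandwich maps\<close>

text \<open>For the derivative $A$ of $F$ at a point, \<open>dirac A\<close> is the value there of
$\sum_k \psi_k \partial_k F$. Treating the operator as a function of the linear map $A$ keeps the algebra of
quaternions apart from the analysis.\<close>

definition dirac :: "(real ^ 4 \<Rightarrow> quat) \<Rightarrow> quat" where
  "dirac A = (\<Sum>k\<in>UNIV. psi (axis k 1) * A (axis k 1))"

lemma vec_4_sum: "(v :: real ^ 4) = (\<Sum>k\<in>UNIV. v $ k *\<^sub>R axis k 1)"
  using basis_expansion[of v] by (simp add: scalar_mult_eq_scaleR)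

lemma dirac_add: "dirac (\<lambda>v. A v + B v) = dirac A + dirac B"
  by (simp add: dirac_def distrib_left sum.distrib)

lemma dirac_scaleR: "dirac (\<lambda>v. t *\<^sub>R A v) = t *\<^sub>R dirac A"
  by (simp add: dirac_def scaleR_sum_right)

lemma dirac_mult_right: "dirac (\<lambda>v. A v * h) = dirac A * h"
  by (simp add: dirac_def sum_distrib_right mult.assoc)

lemma dirac_inner: "dirac (\<lambda>v. (m \<bullet> v) *\<^sub>R h) = psi m * h"
proof -
  have "psi m = (\<Sum>k\<in>UNIV. m $ k *\<^sub>R psi (axis k 1))"
    by (subst vec_4_sum) (simp only: linear_sum[OF linear_psi] linear_cmul[OF linear_psi])
  then show ?thesis
    by (simp add: dirac_def inner_axis sum_distrib_right)
qed

lemma axis_4_component [simp]: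
  "axis (0::4) (1::real) $ 0 = 1" "axis (0::4) (1::real) $ 1 = 0"
  "axis (0::4) (1::real) $ 2 = 0" "axis (0::4) (1::real) $ 3 = 0"
  "axis (1::4) (1::real) $ 0 = 0" "axis (1::4) (1::real) $ 1 = 1"
  "axis (1::4) (1::real) $ 2 = 0" "axis (1::4) (1::real) $ 3 = 0"
  "axis (2::4) (1::real) $ 0 = 0" "axis (2::4) (1::real) $ 1 = 0"
  "axis (2::4) (1::real) $ 2 = 1" "axis (2::4) (1::real) $ 3 = 0"
  "axis (3::4) (1::real) $ 0 = 0" "axis (3::4) (1::real) $ 1 = 0"
  "axis (3::4) (1::real) $ 2 = 0" "axis (3::4) (1::real) $ 3 = 1"
  by (simp_all add: axis_def)

lemma dirac_const_mult_psi: "dirac (\<lambda>v. k * psi v) = - 2 *\<^sub>R qcnj k"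
  by (simp add: dirac_def sum_univ_4 quat_eq_iff quat_mult_sel qcnj_def)

text \<open>The trace of a bilinear map does not depend on the orthonormal frame: the coefficients of the rotated
frame form an orthogonal matrix, whose rows are again orthonormal.\<close>

lemma sum_orthogonal_frame:
  fixes M :: "'a::euclidean_space \<Rightarrow> 'a" and B :: "'a \<Rightarrow> 'a \<Rightarrow> 'b::real_vector"
  assumes M: "orthogonal_transformation M" and B: "bilinear B"
  shows "(\<Sum>i\<in>Basis. B (M i) (M i)) = (\<Sum>i\<in>Basis. B i i)"
proof -
  define N where "N = inv M"
  have N: "orthogonal_transformation N"
    unfolding N_def by (rule orthogonal_transformation_inv[OF M])
  have MN: "M (N x) = x" for x
    unfolding N_def using orthogonal_transformation_surj[OF M] by (simp add: surj_f_inv_f)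
  have adj: "M i \<bullet> j = i \<bullet> N j" for i j
    by (metis M MN orthogonal_transformation_def)
  have lin1: "linear (\<lambda>x. B x y)" and lin2: "linear (B x)" for x y
    using B by (auto simp: bilinear_def)
  have "B (M i) (M i) = (\<Sum>j\<in>Basis. \<Sum>l\<in>Basis. ((i \<bullet> N j) * (i \<bullet> N l)) *\<^sub>R B j l)" for i
  proof -
    have "B (M i) (M i) = B (\<Sum>j\<in>Basis. (M i \<bullet> j) *\<^sub>R j) (\<Sum>l\<in>Basis. (M i \<bullet> l) *\<^sub>R l)"
      by (simp add: euclidean_representation)
    also have "\<dots> = (\<Sum>j\<in>Basis. \<Sum>l\<in>Basis. ((M i \<bullet> j) * (M i \<bullet> l)) *\<^sub>R B j l)"
      unfolding linear_sum[OF lin1] linear_cmul[OF lin1]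
      by (simp add: linear_sum[OF lin2] linear_cmul[OF lin2] scaleR_sum_right)
    finally show ?thesis by (simp add: adj)
  qed
  then have "(\<Sum>i\<in>Basis. B (M i) (M i))
      = (\<Sum>i\<in>Basis. \<Sum>j\<in>Basis. \<Sum>l\<in>Basis. ((i \<bullet> N j) * (i \<bullet> N l)) *\<^sub>R B j l)"
    by simp
  also have "\<dots> = (\<Sum>j\<in>Basis. \<Sum>i\<in>Basis. \<Sum>l\<in>Basis. ((i \<bullet> N j) * (i \<bullet> N l)) *\<^sub>R B j l)"
    by (rule sum.swap)
  also have "\<dots> = (\<Sum>j\<in>Basis. \<Sum>l\<in>Basis. \<Sum>i\<in>Basis. ((i \<bullet> N j) * (i \<bullet> N l)) *\<^sub>R B j l)"
    by (intro sum.cong refl sum.swap)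
  also have "\<dots> = (\<Sum>j\<in>Basis. \<Sum>l\<in>Basis. (N j \<bullet> N l) *\<^sub>R B j l)"
    by (simp add: euclidean_inner[of "N _" "N _"] scaleR_sum_left inner_commute)
  also have "\<dots> = (\<Sum>j\<in>Basis. \<Sum>l\<in>Basis. (if l = j then 1 else 0) *\<^sub>R B j l)"
    using N by (intro sum.cong refl arg_cong2[where f = scaleR])
       (auto simp: orthogonal_transformation_def inner_Basis)
  also have "\<dots> = (\<Sum>j\<in>Basis. B j j)"
    by (simp add: if_distrib[of "\<lambda>t. t *\<^sub>R _"] cong: if_cong)
  finally show ?thesis .
qed

lemma sum_Basis_axis: "(\<Sum>i\<in>Basis. h i) = (\<Sum>k\<in>UNIV. h (axis k (1::real)))"
proof -
  have B: "(Basis :: (real ^ 'n) set) = (\<lambda>k. axis k 1) ` UNIV"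
    by (auto simp: Basis_vec_def)
  show ?thesis
    unfolding B by (subst sum.reindex) (auto simp: inj_on_def axis_eq_axis)
qed

text \<open>The differential of a Moebius transformation of the quaternions has this form at every point.\<close>

definition sandwich :: "quat \<Rightarrow> quat \<Rightarrow> real ^ 4 \<Rightarrow> real ^ 4" where
  "sandwich p s v = psi_inv (p * psi v * s)"

lemma bounded_linear_sandwich: "bounded_linear (sandwich p s)"
  unfolding sandwich_def
  by (intro bounded_linear_compose[OF bounded_linear_psi_inv] bounded_linear_mult_const
      bounded_linear_const_mult bounded_linear_psi)

lemma norm_sandwich: "norm (sandwich p s v) = norm p * norm s * norm v"
  by (simp add: sandwich_def norm_mult)

text \<open>The norm of quaternions is multiplicative, so a sandwich map scales all lengths by the same factor.\<close>

lemma sandwich_orthogonal: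
  assumes "p \<noteq> 0" "s \<noteq> 0"
  obtains M where "orthogonal_transformation M" "sandwich p s = (\<lambda>v. (norm p * norm s) *\<^sub>R M v)"
proof
  let ?M = "\<lambda>v. inverse (norm p * norm s) *\<^sub>R sandwich p s v"
  show "orthogonal_transformation ?M"
    unfolding orthogonal_transformation
    using assms bounded_linear.linear[OF bounded_linear_sandwich, of p s]
    by (auto simp: norm_sandwich divide_simps intro: linear_compose_scale_right)
  show "sandwich p s = (\<lambda>v. (norm p * norm s) *\<^sub>R ?M v)"
    using assms by (simp add: field_simps)
qed

lemma abs_det_sandwich:
  assumes "p \<noteq> 0" "s \<noteq> 0"
  shows "\<bar>det (matrix (sandwich p s))\<bar> = (norm p * norm s) ^ 4"
proof -
  obtain M where M: "orthogonal_transformation M"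
    and eq: "sandwich p s = (\<lambda>v. (norm p * norm s) *\<^sub>R M v)"
    using sandwich_orthogonal[OF assms] .
  have "matrix (sandwich p s) = matrix ((*\<^sub>R) (norm p * norm s)) ** matrix M"
    unfolding eq
    by (subst matrix_compose[symmetric])
       (simp_all add: o_def orthogonal_transformation_linear[OF M]
          bounded_linear.linear[OF bounded_linear_scaleR_right])
  then show ?thesis
    using orthogonal_transformation_det[OF M]
    by (simp add: abs_mult det_mul det_matrix_scaleR)
qed

text \<open>Since $\psi_k s = p^{-1} (p\, \psi_k\, s)$, the sum defining the left side is $p^{-1}$ times the trace of
$(v, w) \mapsto v\, A(w)$ in the frame $p\, \psi_k\, s$, which is orthonormal up to the factor $|p|\,|s|$.
This cancellation is why the factor standing before $A$ has to be $s$, up to a real multiple.\<close>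

lemma dirac_sandwich:
  assumes A: "linear A"
  shows "dirac (\<lambda>v. s * A (sandwich p s v)) = (norm s)\<^sup>2 *\<^sub>R (qcnj p * dirac A)"
proof (cases "p = 0 \<or> s = 0")
  case True
  then show ?thesis
    using linear_0[OF A] linear_0[OF bounded_linear.linear[OF bounded_linear_psi_inv]]
    by (auto simp: dirac_def sandwich_def qcnj_eq_inverse)
next
  case False
  then have nz: "p \<noteq> 0" "s \<noteq> 0" by auto
  define m where "m = norm p * norm s"
  obtain M where M: "orthogonal_transformation M"
    and eq: "sandwich p s = (\<lambda>v. m *\<^sub>R M v)"
    using sandwich_orthogonal[OF nz] unfolding m_def .
  have "psi v * (s * A (sandwich p s v)) = m\<^sup>2 *\<^sub>R (inverse p * (psi (M v) * A (M v)))" for v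
  proof -
    have "psi v * s = inverse p * psi (sandwich p s v)"
      unfolding sandwich_def psi_psi_inv mult.assoc
      using nz by (metis left_inverse mult.assoc mult_1_left)
    then have "psi v * (s * A (sandwich p s v))
        = inverse p * psi (sandwich p s v) * A (sandwich p s v)"
      by (simp flip: mult.assoc)
    then show ?thesis
      unfolding eq
      by (simp add: linear_cmul[OF A] linear_cmul[OF linear_psi]
          power2_eq_square mult.assoc)
  qed
  then have "dirac (\<lambda>v. s * A (sandwich p s v))
      = m\<^sup>2 *\<^sub>R (inverse p * (\<Sum>i\<in>Basis. psi (M i) * A (M i)))"
    by (simp add: dirac_def sum_Basis_axis scaleR_sum_right sum_distrib_left)
  also have "(\<Sum>i\<in>Basis. psi (M i) * A (M i)) = dirac A"
  proof -
    have "bilinear (\<lambda>v w. psi v * A w)"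
      using A linear_psi
      by (auto simp: bilinear_def linear_iff algebra_simps)
    from sum_orthogonal_frame[OF M this] show ?thesis
      by (simp add: dirac_def sum_Basis_axis)
  qed
  finally show ?thesis
    by (simp add: m_def qcnj_eq_inverse power_mult_distrib mult.commute)
qed

section \<open>Continuously differentiable maps\<close>

text \<open>The codomain may be any normed space, so that quaternion-valued functions, point maps and real functions
share one calculus; continuity of the derivative is required in each direction separately, which in finite
dimension is the same as continuity in the operator norm.\<close>

definition C1_map :: "'a::euclidean_space set \<Rightarrow> ('a \<Rightarrow> 'b::real_normed_vector) \<Rightarrow> bool" where
  "C1_map S f \<longleftrightarrow> (\<exists>f'. (\<forall>x\<in>S. (f has_derivative f' x) (at x)) \<and> (\<forall>v. continuous_on S (\<lambda>x. f' x v)))"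

lemma C1_mapI:
  assumes "\<And>x. x \<in> S \<Longrightarrow> (f has_derivative f' x) (at x)" "\<And>v. continuous_on S (\<lambda>x. f' x v)"
  shows "C1_map S f"
  using assms unfolding C1_map_def by blast

lemma C1_map_has_derivative:
  assumes "C1_map S f" "x \<in> S"
  shows "(f has_derivative frechet_derivative f (at x)) (at x)"
  using assms unfolding C1_map_def by (metis frechet_derivative_works differentiable_def)

lemma C1_map_continuous_derivative:
  assumes "C1_map S f"
  shows "continuous_on S (\<lambda>x. frechet_derivative f (at x) v)"
proof -
  obtain f' where f': "\<And>x. x \<in> S \<Longrightarrow> (f has_derivative f' x) (at x)"
    "\<And>v. continuous_on S (\<lambda>x. f' x v)"
    using assms unfolding C1_map_def by blast
  show ?thesis
    using f'(2)[of v] by (rule continuous_on_eq) (use frechet_derivative_at[OF f'(1)] in simp)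
qed

lemma C1_map_continuous_on: "C1_map S f \<Longrightarrow> continuous_on S f"
  by (meson C1_map_has_derivative continuous_at_imp_continuous_on has_derivative_continuous)

lemma C1_map_cong:
  assumes "open S" "\<And>x. x \<in> S \<Longrightarrow> f x = g x"
  shows "C1_map S f \<longleftrightarrow> C1_map S g"
proof -
  have "(f has_derivative D) (at x) \<longleftrightarrow> (g has_derivative D) (at x)" if "x \<in> S" for x D
    using has_derivative_transform_within_open[OF _ assms(1) that, of f D UNIV g]
      has_derivative_transform_within_open[OF _ assms(1) that, of g D UNIV f] assms(2)
    by auto
  then show ?thesis unfolding C1_map_def by simp
qed

lemma C1_map_const: "C1_map S (\<lambda>x. k)"
  by (rule C1_mapI[where f' = "\<lambda>x v. 0"]) auto

lemma C1_map_linear: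
  assumes L: "bounded_linear L" and f: "C1_map S f"
  shows "C1_map S (\<lambda>x. L (f x))"
proof (rule C1_mapI)
  show "((\<lambda>x. L (f x)) has_derivative (\<lambda>v. L (frechet_derivative f (at x) v))) (at x)"
    if "x \<in> S" for x
    by (rule bounded_linear.has_derivative[OF L C1_map_has_derivative[OF f that]])
  show "continuous_on S (\<lambda>x. L (frechet_derivative f (at x) v))" for v
    by (intro bounded_linear.continuous_on[OF L] C1_map_continuous_derivative[OF f])
qed

lemma C1_map_bounded_linear: "bounded_linear L \<Longrightarrow> C1_map S L"
  by (rule C1_mapI[where f' = "\<lambda>x. L"]) (auto simp: bounded_linear_imp_has_derivative)

lemma C1_map_add:
  assumes f: "C1_map S f" and g: "C1_map S g"
  shows "C1_map S (\<lambda>x. f x + g x)"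
proof (rule C1_mapI)
  show "((\<lambda>x. f x + g x) has_derivative
      (\<lambda>v. frechet_derivative f (at x) v + frechet_derivative g (at x) v)) (at x)"
    if "x \<in> S" for x
    by (intro has_derivative_add C1_map_has_derivative[OF _ that] f g)
  show "continuous_on S (\<lambda>x. frechet_derivative f (at x) v + frechet_derivative g (at x) v)" for v
    by (intro continuous_on_add C1_map_continuous_derivative f g)
qed

lemma C1_map_bilinear:
  assumes B: "bounded_bilinear B" and f: "C1_map S f" and g: "C1_map S g"
  shows "C1_map S (\<lambda>x. B (f x) (g x))"
proof (rule C1_mapI)
  show "((\<lambda>x. B (f x) (g x)) has_derivative
      (\<lambda>v. B (f x) (frechet_derivative g (at x) v) + B (frechet_derivative f (at x) v) (g x))) (at x)"
    if "x \<in> S" for x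
    by (intro bounded_bilinear.FDERIV[OF B] C1_map_has_derivative[OF _ that] f g)
  show "continuous_on S
      (\<lambda>x. B (f x) (frechet_derivative g (at x) v) + B (frechet_derivative f (at x) v) (g x))" for v
    by (intro continuous_on_add bounded_bilinear.continuous_on[OF B] C1_map_continuous_on
        C1_map_continuous_derivative f g)
qed

lemmas C1_map_mult = C1_map_bilinear[OF bounded_bilinear_mult]
lemmas C1_map_scaleR = C1_map_bilinear[OF bounded_bilinear_scaleR]

lemma C1_map_inverse:
  fixes f :: "'a::euclidean_space \<Rightarrow> 'b::real_normed_div_algebra"
  assumes f: "C1_map S f" and nz: "\<And>x. x \<in> S \<Longrightarrow> f x \<noteq> 0"
  shows "C1_map S (\<lambda>x. inverse (f x))"
proof (rule C1_mapI)
  show "((\<lambda>x. inverse (f x)) has_derivative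
      (\<lambda>v. - (inverse (f x) * frechet_derivative f (at x) v * inverse (f x)))) (at x)"
    if "x \<in> S" for x
    by (intro Deriv.has_derivative_inverse C1_map_has_derivative[OF f that] nz[OF that])
  show "continuous_on S (\<lambda>x. - (inverse (f x) * frechet_derivative f (at x) v * inverse (f x)))" for v
    by (intro continuous_intros C1_map_continuous_on C1_map_continuous_derivative f ballI nz)
qed

lemma C1_map_compose:
  fixes T :: "'a::euclidean_space \<Rightarrow> 'c::euclidean_space"
  assumes T: "C1_map S T" and g: "C1_map U g" and sub: "\<And>x. x \<in> S \<Longrightarrow> T x \<in> U"
  shows "C1_map S (\<lambda>x. g (T x))"
proof (rule C1_mapI)
  let ?T' = "\<lambda>x. frechet_derivative T (at x)" and ?g' = "\<lambda>y. frechet_derivative g (at y)"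
  show "((\<lambda>x. g (T x)) has_derivative (\<lambda>v. ?g' (T x) (?T' x v))) (at x)" if "x \<in> S" for x
    by (rule has_derivative_compose[OF C1_map_has_derivative[OF T that]
          C1_map_has_derivative[OF g sub[OF that]]])
  \<comment> \<open>The direction of the outer derivative varies with the point; expanding it in a basis leaves
      fixed directions only.\<close>
  show "continuous_on S (\<lambda>x. ?g' (T x) (?T' x v))" for v
  proof (rule continuous_on_eq)
    show "continuous_on S (\<lambda>x. \<Sum>i\<in>Basis. (?T' x v \<bullet> i) *\<^sub>R ?g' (T x) i)"
      by (intro continuous_intros C1_map_continuous_derivative[OF T]
          continuous_on_compose2[OF C1_map_continuous_derivative[OF g] C1_map_continuous_on[OF T]])
         (use sub in auto)
    fix x assume "x \<in> S"
    then have lin: "linear (?g' (T x))"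
      using C1_map_has_derivative[OF g sub] has_derivative_linear by blast
    show "(\<Sum>i\<in>Basis. (?T' x v \<bullet> i) *\<^sub>R ?g' (T x) i) = ?g' (T x) (?T' x v)"
      by (subst (3) euclidean_representation[symmetric])
         (simp add: linear_sum[OF lin] linear_cmul[OF lin])
  qed
qed

lemma C1_map_exp: "C1_map UNIV (exp :: real \<Rightarrow> real)"
  by (rule C1_mapI[where f' = "\<lambda>x v. exp x * v"])
     (auto intro!: continuous_intros DERIV_exp[unfolded has_field_derivative_def])

lemma C1_on_iff_C1_map: "C1_on S f \<longleftrightarrow> C1_map S f"
proof
  assume f: "C1_on S f"
  show "C1_map S f"
  proof (rule C1_mapI)
    show der: "(f has_derivative frechet_derivative f (at x)) (at x)" if "x \<in> S" for x
      using f that frechet_derivative_works unfolding C1_on_def by blast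
    show "continuous_on S (\<lambda>x. frechet_derivative f (at x) v)" for v
    proof (rule continuous_on_eq)
      show "continuous_on S (\<lambda>x. \<Sum>k\<in>UNIV. v $ k *\<^sub>R partial_deriv k f x)"
        using f unfolding C1_on_def by (intro continuous_intros) blast
      fix x assume "x \<in> S"
      then have lin: "linear (frechet_derivative f (at x))"
        using der has_derivative_linear by blast
      show "(\<Sum>k\<in>UNIV. v $ k *\<^sub>R partial_deriv k f x) = frechet_derivative f (at x) v"
        unfolding partial_deriv_def
        by (subst (2) vec_4_sum) (simp only: linear_sum[OF lin] linear_cmul[OF lin])
    qed
  qed
next
  assume f: "C1_map S f"
  then show "C1_on S f"
    unfolding C1_on_def partial_deriv_def
    using C1_map_has_derivative C1_map_continuous_derivative differentiable_def by blast
qed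

section \<open>Four-tuples as quaternion-valued functions\<close>

text \<open>The components are taken with respect to the units $1, e_1, e_2, e_3$, whereas points of $\mathbb R^4$ become
quaternions through \<open>psi\<close>, with the opposite sign at $e_2$.\<close>

definition quat_field :: "fun4 \<Rightarrow> real ^ 4 \<Rightarrow> quat" where
  "quat_field = (\<lambda>(f0, f1, f2, f3) x. Quat (f0 x) (f1 x) (f2 x) (f3 x))"

definition tuple_on :: "(real ^ 4) set \<Rightarrow> (real ^ 4 \<Rightarrow> quat) \<Rightarrow> fun4" where
  "tuple_on S F = ((\<lambda>x\<in>S. qRe (F x)), (\<lambda>x\<in>S. qI1 (F x)), (\<lambda>x\<in>S. qI2 (F x)), (\<lambda>x\<in>S. qI3 (F x)))"

lemma tuple_on_four_tuples: "tuple_on S F \<in> four_tuples S"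
  by (simp add: tuple_on_def four_tuples_def)

lemma quat_field_tuple_on: "x \<in> S \<Longrightarrow> quat_field (tuple_on S F) x = F x"
  by (simp add: quat_field_def tuple_on_def)

lemma tuple_on_quat_field: "f \<in> four_tuples S \<Longrightarrow> tuple_on S (quat_field f) = f"
  by (auto simp: quat_field_def tuple_on_def four_tuples_def fun_eq_iff restrict_def
      PiE_def extensional_def)

lemma tuple_on_cong: "(\<And>x. x \<in> S \<Longrightarrow> F x = G x) \<Longrightarrow> tuple_on S F = tuple_on S G"
  by (auto simp: tuple_on_def)

lemma Quat_sum:
  "Quat a b c d = a *\<^sub>R 1 + b *\<^sub>R Quat 0 1 0 0 + c *\<^sub>R Quat 0 0 1 0 + d *\<^sub>R Quat 0 0 0 1"
  by (simp add: quat_eq_iff one_quat_def)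

lemma C1_map_quat_field:
  "C1_map S (quat_field (f0, f1, f2, f3)) \<longleftrightarrow>
     C1_map S f0 \<and> C1_map S f1 \<and> C1_map S f2 \<and> C1_map S f3"
proof safe
  assume F: "C1_map S (quat_field (f0, f1, f2, f3))"
  show "C1_map S f0" using C1_map_linear[OF bounded_linear_quat_sel(1) F] by (simp add: quat_field_def)
  show "C1_map S f1" using C1_map_linear[OF bounded_linear_quat_sel(2) F] by (simp add: quat_field_def)
  show "C1_map S f2" using C1_map_linear[OF bounded_linear_quat_sel(3) F] by (simp add: quat_field_def)
  show "C1_map S f3" using C1_map_linear[OF bounded_linear_quat_sel(4) F] by (simp add: quat_field_def)
next
  assume "C1_map S f0" "C1_map S f1" "C1_map S f2" "C1_map S f3"
  then show "C1_map S (quat_field (f0, f1, f2, f3))"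
    unfolding quat_field_def prod.case
    by (subst Quat_sum) (intro C1_map_add C1_map_scaleR C1_map_const)
qed

lemma frechet_derivative_quat_field:
  assumes "f0 differentiable (at x)" "f1 differentiable (at x)"
    "f2 differentiable (at x)" "f3 differentiable (at x)"
  shows "frechet_derivative (quat_field (f0, f1, f2, f3)) (at x) = (\<lambda>v.
     Quat (frechet_derivative f0 (at x) v) (frechet_derivative f1 (at x) v)
       (frechet_derivative f2 (at x) v) (frechet_derivative f3 (at x) v))"
  using assms unfolding frechet_derivative_works quat_field_def prod.case
  by (intro frechet_derivative_at[symmetric], subst (1 2) Quat_sum)
     (intro has_derivative_add has_derivative_scaleR_left)

lemma cimmino_system_iff_dirac:
  assumes "C1_map S (quat_field f)"
  shows "cimmino_system S \<delta> f \<longleftrightarrow>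
     (\<forall>x\<in>S. dirac (frechet_derivative (quat_field f) (at x)) + \<delta> x * quat_field f x = 0)"
proof -
  obtain f0 f1 f2 f3 where f: "f = (f0, f1, f2, f3)"
    by (cases f)
  have "C1_map S f0" "C1_map S f1" "C1_map S f2" "C1_map S f3"
    using assms unfolding f C1_map_quat_field by auto
  then have D: "x \<in> S \<Longrightarrow> frechet_derivative (quat_field f) (at x) = (\<lambda>v.
     Quat (frechet_derivative f0 (at x) v) (frechet_derivative f1 (at x) v)
       (frechet_derivative f2 (at x) v) (frechet_derivative f3 (at x) v))" for x
    unfolding f using C1_map_has_derivative differentiable_def
    by (blast intro!: frechet_derivative_quat_field)
  show ?thesis
    unfolding cimmino_system_def f prod.case Let_def
    by (rule ball_cong[OF refl], unfold D[unfolded f])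
       (simp add: dirac_def sum_univ_4 quat_eq_iff quat_mult_sel quat_field_def psi_coord_def
          flip: partial_deriv_def; argo)
qed

text \<open>The quaternionic counterpart of \<open>CB\<close>, without its extensional encoding of functions on \<open>S\<close>.\<close>

definition dirac_solution ::
  "(real ^ 4) set \<Rightarrow> (real ^ 4 \<Rightarrow> quat) \<Rightarrow> (real ^ 4 \<Rightarrow> real) \<Rightarrow> (real ^ 4 \<Rightarrow> quat) \<Rightarrow> bool" where
  "dirac_solution S \<delta> w F \<longleftrightarrow> C1_map S F \<and>
     (\<forall>x\<in>S. dirac (frechet_derivative F (at x)) + \<delta> x * F x = 0) \<and>
     set_integrable lebesgue S (\<lambda>x. (norm (F x))\<^sup>2 * w x)"

lemma set_borel_measurable_continuous_open:
  fixes h :: "'a::euclidean_space \<Rightarrow> real"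
  assumes "open S" "continuous_on S h"
  shows "set_borel_measurable lebesgue S h"
proof -
  have "(\<lambda>x. indicat_real S x *\<^sub>R h x) \<in> borel_measurable borel"
    using borel_measurable_continuous_on_indicator[OF _ assms(2)] assms(1) by simp
  then show ?thesis
    unfolding set_borel_measurable_def by (simp add: measurable_completion)
qed

text \<open>Each $|f_k|^2$ is bounded by $|F|^2 = \sum_k |f_k|^2$, and continuity of $f_k$ and $w$ supplies the
measurability that the comparison needs.\<close>

lemma CB_iff_dirac_solution:
  assumes S: "open S" and w: "continuous_on S w" "\<forall>x\<in>S. 0 \<le> w x"
    and f: "f \<in> four_tuples S"
  shows "f \<in> CB S \<delta> w \<longleftrightarrow> dirac_solution S \<delta> w (quat_field f)"
proof -
  obtain f0 f1 f2 f3 where f4: "f = (f0, f1, f2, f3)"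
    by (cases f)
  let ?F = "quat_field f"
  have norm_F: "(norm (?F x))\<^sup>2 * w x
      = \<bar>f0 x\<bar>\<^sup>2 * w x + \<bar>f1 x\<bar>\<^sup>2 * w x + \<bar>f2 x\<bar>\<^sup>2 * w x + \<bar>f3 x\<bar>\<^sup>2 * w x" for x
    by (simp add: f4 quat_field_def quat_norm_sq algebra_simps)
  have int: "set_integrable lebesgue S (\<lambda>x. (norm (?F x))\<^sup>2 * w x) \<longleftrightarrow>
      weighted_L2 S w f0 \<and> weighted_L2 S w f1 \<and> weighted_L2 S w f2 \<and> weighted_L2 S w f3"
    if C: "C1_map S f0" "C1_map S f1" "C1_map S f2" "C1_map S f3"
  proof
    assume I: "set_integrable lebesgue S (\<lambda>x. (norm (?F x))\<^sup>2 * w x)"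
    have part: "weighted_L2 S w h" if h: "C1_map S h"
      and le: "\<And>x. \<bar>h x\<bar>\<^sup>2 \<le> (norm (?F x))\<^sup>2" for h
      unfolding weighted_L2_def
    proof (rule set_integrable_bound[OF I])
      show "set_borel_measurable lebesgue S (\<lambda>x. \<bar>h x\<bar>\<^sup>2 * w x)"
        by (intro set_borel_measurable_continuous_open[OF S] continuous_intros
            C1_map_continuous_on[OF h] w(1))
      show "AE x\<in>S in lebesgue. norm (\<bar>h x\<bar>\<^sup>2 * w x) \<le> norm ((norm (?F x))\<^sup>2 * w x)"
        using w(2) le by (auto simp: abs_mult intro!: AE_I2 mult_right_mono)
    qed
    show "weighted_L2 S w f0 \<and> weighted_L2 S w f1 \<and> weighted_L2 S w f2 \<and> weighted_L2 S w f3"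
      by (intro conjI part C) (simp_all add: f4 quat_field_def quat_norm_sq)
  next
    assume "weighted_L2 S w f0 \<and> weighted_L2 S w f1 \<and> weighted_L2 S w f2 \<and> weighted_L2 S w f3"
    then show "set_integrable lebesgue S (\<lambda>x. (norm (?F x))\<^sup>2 * w x)"
      unfolding norm_F weighted_L2_def by (intro set_integral_add(1)) auto
  qed
  show ?thesis
    using f cimmino_system_iff_dirac[of S f \<delta>] int C1_map_quat_field[of S f0 f1 f2 f3]
    unfolding f4 CB_def dirac_solution_def C1_on_iff_C1_map by blast
qed

section \<open>Linear structure of the solution spaces\<close>

lemma CB_subset_four_tuples: "CB S \<delta> w \<subseteq> four_tuples S"
  by (auto simp: CB_def)

lemma add4_eq: "add4 S f h = tuple_on S (\<lambda>x. quat_field f x + quat_field h x)"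
  by (cases f; cases h) (simp add: add4_def tuple_on_def quat_field_def)

lemma scale4_eq: "scale4 S t f = tuple_on S (\<lambda>x. t *\<^sub>R quat_field f x)"
  by (cases f) (simp add: scale4_def tuple_on_def quat_field_def)

lemma zero4_eq: "zero4 S = tuple_on S (\<lambda>x. 0)"
  by (simp add: zero4_def tuple_on_def)

lemma dirac_solution_cong:
  assumes S: "open S" and eq: "\<And>x. x \<in> S \<Longrightarrow> F x = G x"
  shows "dirac_solution S \<delta> w F \<longleftrightarrow> dirac_solution S \<delta> w G"
proof -
  have D: "frechet_derivative F (at x) = frechet_derivative G (at x)"
    if "C1_map S F" "x \<in> S" for x
    using has_derivative_transform_within_open[OF C1_map_has_derivative[OF that] S that(2) eq]
    by (rule frechet_derivative_at)
  have "set_integrable lebesgue S (\<lambda>x. (norm (F x))\<^sup>2 * w x) \<longleftrightarrow>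
      set_integrable lebesgue S (\<lambda>x. (norm (G x))\<^sup>2 * w x)"
    by (rule set_integrable_cong) (simp_all add: eq)
  then show ?thesis
    unfolding dirac_solution_def using C1_map_cong[OF S eq] D eq by auto
qed

lemma tuple_on_mem_CB:
  assumes "open S" "continuous_on S w" "\<forall>x\<in>S. 0 \<le> w x"
  shows "tuple_on S F \<in> CB S \<delta> w \<longleftrightarrow> dirac_solution S \<delta> w F"
  unfolding CB_iff_dirac_solution[OF assms tuple_on_four_tuples]
  by (intro dirac_solution_cong assms(1) quat_field_tuple_on)

lemma dirac_solution_zero: "dirac_solution S \<delta> w (\<lambda>x. 0)"
  by (simp add: dirac_solution_def C1_map_const dirac_def set_integrable_def)

lemma dirac_solution_scaleR:
  assumes F: "dirac_solution S \<delta> w F"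
  shows "dirac_solution S \<delta> w (\<lambda>x. t *\<^sub>R F x)"
proof -
  have C: "C1_map S F" and I: "set_integrable lebesgue S (\<lambda>x. (norm (F x))\<^sup>2 * w x)"
    and D: "\<And>x. x \<in> S \<Longrightarrow> dirac (frechet_derivative F (at x)) + \<delta> x * F x = 0"
    using F unfolding dirac_solution_def by auto
  have "dirac (frechet_derivative (\<lambda>x. t *\<^sub>R F x) (at x)) + \<delta> x * (t *\<^sub>R F x) = 0" if x: "x \<in> S" for x
    using D[OF x] frechet_derivative_at[OF has_derivative_scaleR_right[OF C1_map_has_derivative[OF C x]], of t, symmetric]
    by (simp add: dirac_scaleR flip: scaleR_right_distrib)
  moreover have "set_integrable lebesgue S (\<lambda>x. (norm (t *\<^sub>R F x))\<^sup>2 * w x)"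
    using set_integrable_mult_right[OF I, of "t\<^sup>2"] by (simp add: power_mult_distrib mult.assoc)
  ultimately show ?thesis
    unfolding dirac_solution_def using C1_map_scaleR[OF C1_map_const C] by blast
qed

text \<open>The system is linear in $F$; the integrability condition is not, and for it the parallelogram law bounds
$|F + G|^2$ by $2 |F|^2 + 2 |G|^2$.\<close>

lemma dirac_solution_add:
  assumes S: "open S" and w: "continuous_on S w" "\<forall>x\<in>S. 0 \<le> w x"
    and F: "dirac_solution S \<delta> w F" and G: "dirac_solution S \<delta> w G"
  shows "dirac_solution S \<delta> w (\<lambda>x. F x + G x)"
proof -
  have C: "C1_map S F" "C1_map S G"
    and I: "set_integrable lebesgue S (\<lambda>x. (norm (F x))\<^sup>2 * w x)"
      "set_integrable lebesgue S (\<lambda>x. (norm (G x))\<^sup>2 * w x)"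
    and D: "\<And>x. x \<in> S \<Longrightarrow> dirac (frechet_derivative F (at x)) + \<delta> x * F x = 0"
      "\<And>x. x \<in> S \<Longrightarrow> dirac (frechet_derivative G (at x)) + \<delta> x * G x = 0"
    using F G unfolding dirac_solution_def by auto
  have C_sum: "C1_map S (\<lambda>x. F x + G x)"
    by (rule C1_map_add[OF C])
  have "dirac (frechet_derivative (\<lambda>x. F x + G x) (at x)) + \<delta> x * (F x + G x) = 0" if x: "x \<in> S" for x
  proof -
    have "frechet_derivative (\<lambda>x. F x + G x) (at x)
        = (\<lambda>v. frechet_derivative F (at x) v + frechet_derivative G (at x) v)"
      by (intro frechet_derivative_at[symmetric] has_derivative_add C1_map_has_derivative[OF _ x] C)
    then have "dirac (frechet_derivative (\<lambda>x. F x + G x) (at x)) + \<delta> x * (F x + G x)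
        = (dirac (frechet_derivative F (at x)) + \<delta> x * F x)
          + (dirac (frechet_derivative G (at x)) + \<delta> x * G x)"
      by (simp add: dirac_add distrib_left)
    then show ?thesis by (simp add: D x)
  qed
  moreover have "set_integrable lebesgue S (\<lambda>x. (norm (F x + G x))\<^sup>2 * w x)"
  proof (rule set_integrable_bound)
    show "set_integrable lebesgue S (\<lambda>x. 2 * ((norm (F x))\<^sup>2 * w x + (norm (G x))\<^sup>2 * w x))"
      by (intro set_integrable_mult_right set_integral_add(1) I)
    show "set_borel_measurable lebesgue S (\<lambda>x. (norm (F x + G x))\<^sup>2 * w x)"
      by (intro set_borel_measurable_continuous_open[OF S] continuous_intros
          C1_map_continuous_on C w(1))
    have "(norm (F x + G x))\<^sup>2 * w x \<le> 2 * ((norm (F x))\<^sup>2 * w x + (norm (G x))\<^sup>2 * w x)" if "x \<in> S" for x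
    proof -
      have "(norm (F x + G x))\<^sup>2 + (norm (F x - G x))\<^sup>2 = 2 * ((norm (F x))\<^sup>2 + (norm (G x))\<^sup>2)"
        by (simp add: power2_norm_eq_inner inner_simps inner_commute)
      then have "(norm (F x + G x))\<^sup>2 \<le> 2 * ((norm (F x))\<^sup>2 + (norm (G x))\<^sup>2)"
        by (metis le_add_same_cancel1 zero_le_power2)
      from mult_right_mono[OF this bspec[OF w(2) that]] show ?thesis
        by (simp add: algebra_simps)
    qed
    then show "AE x\<in>S in lebesgue. norm ((norm (F x + G x))\<^sup>2 * w x)
        \<le> norm (2 * ((norm (F x))\<^sup>2 * w x + (norm (G x))\<^sup>2 * w x))"
      using w(2) by (auto simp: abs_mult)
  qed
  ultimately show ?thesis
    unfolding dirac_solution_def using C_sum by blast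
qed

lemma real_function_space_CB:
  assumes S: "open S" and w: "continuous_on S w" "\<forall>x\<in>S. 0 \<le> w x"
  shows "real_function_space S (CB S \<delta> w)"
proof -
  note mem = tuple_on_mem_CB[OF S w]
  have sol: "dirac_solution S \<delta> w (quat_field f)" if "f \<in> CB S \<delta> w" for f
    using that CB_iff_dirac_solution[OF S w, of f \<delta>] CB_subset_four_tuples by blast
  show ?thesis
    unfolding real_function_space_def zero4_eq add4_eq scale4_eq mem
    using sol dirac_solution_zero dirac_solution_scaleR dirac_solution_add[OF S w]
      CB_subset_four_tuples by blast
qed

section \<open>Conformal intertwining\<close>

text \<open>The change of variables theorem is stated for vector-valued integrands; a real integrand is read as a
vector with one coordinate.\<close>

lemma integrable_change_of_variables_real_valued:
  fixes h :: "real ^ 'm::{finite,wellorder} \<Rightarrow> real" and g :: "real ^ 'm::_ \<Rightarrow> real ^ 'm::_"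
  assumes "S \<in> sets lebesgue"
    and "\<And>x. x \<in> S \<Longrightarrow> (g has_derivative g' x) (at x within S)"
    and "inj_on g S"
  shows "h absolutely_integrable_on (g ` S) \<longleftrightarrow>
     (\<lambda>x. \<bar>det (matrix (g' x))\<bar> * h (g x)) absolutely_integrable_on S"
proof -
  have vec: "k absolutely_integrable_on A \<longleftrightarrow> (\<lambda>x. vec (k x) :: real ^ 1) absolutely_integrable_on A"
    for k :: "real ^ 'm::_ \<Rightarrow> real" and A
    by (subst (2) absolutely_integrable_componentwise_iff) (simp add: Basis_vec_def inner_axis)
  have "(\<lambda>x. vec (\<bar>det (matrix (g' x))\<bar> * h (g x)) :: real ^ 1)
      = (\<lambda>x. \<bar>det (matrix (g' x))\<bar> *\<^sub>R vec (h (g x)))"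
    by (simp add: fun_eq_iff vec_eq_iff)
  then show ?thesis
    unfolding vec using absolutely_integrable_change_of_variables[OF assms, of "\<lambda>x. vec (h x) :: real ^ 1"]
    by simp
qed

text \<open>What the transfer of solutions uses of a Moebius transformation $T$ and its factor $C$: the differential of
$T$ is the sandwich map with factors $p$ and $s$, and $C$ is monogenic and parallel to the right factor $s$.\<close>

locale conformal_intertwiner =
  fixes \<Xi> \<Omega> :: "(real ^ 4) set" and T Tinv :: "real ^ 4 \<Rightarrow> real ^ 4" and p s C :: "real ^ 4 \<Rightarrow> quat"
  assumes open_\<Xi>: "open \<Xi>" and open_\<Omega>: "open \<Omega>"
    and image_T: "T ` \<Xi> = \<Omega>" and Tinv_T: "\<And>x. x \<in> \<Xi> \<Longrightarrow> Tinv (T x) = x"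
    and C1_T: "C1_map \<Xi> T" and C1_Tinv: "C1_map \<Omega> Tinv" and C1_C: "C1_map \<Xi> C"
    and T_deriv: "\<And>x. x \<in> \<Xi> \<Longrightarrow> (T has_derivative sandwich (p x) (s x)) (at x)"
    and p_nz: "\<And>x. x \<in> \<Xi> \<Longrightarrow> p x \<noteq> 0" and s_nz: "\<And>x. x \<in> \<Xi> \<Longrightarrow> s x \<noteq> 0"
    and C_parallel: "\<And>x. x \<in> \<Xi> \<Longrightarrow> \<exists>\<kappa>. \<kappa> \<noteq> 0 \<and> C x = \<kappa> *\<^sub>R s x"
    and C_monogenic: "\<And>x. x \<in> \<Xi> \<Longrightarrow> dirac (frechet_derivative C (at x)) = 0"
begin

lemma T_in: "x \<in> \<Xi> \<Longrightarrow> T x \<in> \<Omega>"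
  using image_T by blast

lemma Tinv_in: "y \<in> \<Omega> \<Longrightarrow> Tinv y \<in> \<Xi>"
  using image_T Tinv_T by auto

lemma T_Tinv: "y \<in> \<Omega> \<Longrightarrow> T (Tinv y) = y"
  using image_T Tinv_T by auto

lemma C_nz: "x \<in> \<Xi> \<Longrightarrow> C x \<noteq> 0"
  using C_parallel s_nz by fastforce

definition transform :: "real ^ 4 \<Rightarrow> (real ^ 4 \<Rightarrow> quat) \<Rightarrow> real ^ 4 \<Rightarrow> quat" where
  "transform m F x = exp (m \<bullet> x) *\<^sub>R (C x * F (T x))"

definition untransform :: "real ^ 4 \<Rightarrow> (real ^ 4 \<Rightarrow> quat) \<Rightarrow> real ^ 4 \<Rightarrow> quat" where
  "untransform m G y = exp (- m \<bullet> Tinv y) *\<^sub>R (inverse (C (Tinv y)) * G (Tinv y))"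

lemma transform_untransform:
  assumes "x \<in> \<Xi>"
  shows "transform m (untransform m G) x = G x"
  using C_nz[OF assms]
  by (simp add: transform_def untransform_def Tinv_T[OF assms] flip: mult.assoc exp_add)

lemma untransform_transform:
  assumes "y \<in> \<Omega>"
  shows "untransform m (transform m F) y = F y"
  using C_nz[OF Tinv_in[OF assms]]
  by (simp add: transform_def untransform_def T_Tinv[OF assms] flip: mult.assoc exp_add)

lemma C1_map_exp_inner: "C1_map S (\<lambda>x. exp (m \<bullet> x))"
  by (rule C1_map_compose[OF C1_map_bounded_linear[OF bounded_linear_inner_right] C1_map_exp]) simp

text \<open>Regularity passes back from the transformed function through the explicit inverse.\<close>

lemma C1_map_transform_iff: "C1_map \<Xi> (transform m F) \<longleftrightarrow> C1_map \<Omega> F"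
proof
  assume "C1_map \<Omega> F"
  then have "C1_map \<Xi> (\<lambda>x. F (T x))"
    using C1_map_compose[OF C1_T] T_in by blast
  then show "C1_map \<Xi> (transform m F)"
    unfolding transform_def by (intro C1_map_scaleR C1_map_mult C1_map_exp_inner C1_C)
next
  assume "C1_map \<Xi> (transform m F)"
  then have "C1_map \<Xi> (\<lambda>x. exp (- m \<bullet> x) *\<^sub>R (inverse (C x) * transform m F x))"
    by (intro C1_map_scaleR C1_map_mult C1_map_exp_inner C1_map_inverse C1_C C_nz)
  then have "C1_map \<Omega> (untransform m (transform m F))"
    unfolding untransform_def using C1_map_compose[OF C1_Tinv _ Tinv_in] by blast
  then show "C1_map \<Omega> F"
    by (subst C1_map_cong[OF open_\<Omega> untransform_transform[symmetric]])
qed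

text \<open>The product rule gives three terms. The one with the derivative of $C$ vanishes by monogenicity, the one with
the derivative of $F$ is evaluated by \<open>dirac_sandwich\<close>, and the exponential turns $q$ into $r$. Then
$r\, C = \kappa\, r\, s$ is $\kappa |s|^2\, \overline{p}\, \delta$, because $\overline{p}\, p = |p|^2$.\<close>

lemma dirac_transform:
  assumes F: "C1_map \<Omega> F" and x: "x \<in> \<Xi>" and C: "C x = \<kappa> *\<^sub>R s x"
    and \<delta>: "\<delta> = (p x * psi r * s x) /\<^sub>R (norm (p x) * norm (s x))\<^sup>2"
  shows "dirac (frechet_derivative (transform (r - q) F) (at x)) + psi q * transform (r - q) F x
    = (exp ((r - q) \<bullet> x) * \<kappa> * (norm (s x))\<^sup>2) *\<^sub>R
        (qcnj (p x) * (dirac (frechet_derivative F (at (T x))) + \<delta> * F (T x)))"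
proof -
  let ?m = "r - q" and ?e = "exp ((r - q) \<bullet> x)" and ?h = "C x * F (T x)"
  let ?C' = "frechet_derivative C (at x)" and ?F' = "frechet_derivative F (at (T x))"
  have F': "(F has_derivative ?F') (at (T x))"
    by (rule C1_map_has_derivative[OF F T_in[OF x]])
  have e': "((\<lambda>x. exp (?m \<bullet> x)) has_derivative (\<lambda>v. ?e * (?m \<bullet> v))) (at x)"
    by (auto intro!: derivative_eq_intros)
  have "((\<lambda>x. exp (?m \<bullet> x) *\<^sub>R (C x * F (T x))) has_derivative
      (\<lambda>v. ?e *\<^sub>R (C x * ?F' (sandwich (p x) (s x) v) + ?C' v * F (T x)) + (?e * (?m \<bullet> v)) *\<^sub>R ?h)) (at x)"
    by (intro has_derivative_scaleR e' has_derivative_mult C1_map_has_derivative[OF C1_C x]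
        has_derivative_compose[OF T_deriv[OF x] F'])
  then have G': "frechet_derivative (transform ?m F) (at x) =
      (\<lambda>v. ?e *\<^sub>R (\<kappa> *\<^sub>R (s x * ?F' (sandwich (p x) (s x) v)) + ?C' v * F (T x) + (?m \<bullet> v) *\<^sub>R ?h))"
    unfolding transform_def
    by (subst frechet_derivative_at[symmetric]) (auto simp: C algebra_simps)
  have "dirac (frechet_derivative (transform ?m F) (at x)) =
      ?e *\<^sub>R (\<kappa> *\<^sub>R ((norm (s x))\<^sup>2 *\<^sub>R (qcnj (p x) * dirac ?F')) + psi ?m * ?h)"
    unfolding G' dirac_add dirac_scaleR dirac_mult_right dirac_inner
      dirac_sandwich[OF has_derivative_linear[OF F']] C_monogenic[OF x]
    by simp
  also have "\<dots> + psi q * transform ?m F x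
      = ?e *\<^sub>R (\<kappa> *\<^sub>R ((norm (s x))\<^sup>2 *\<^sub>R (qcnj (p x) * dirac ?F')) + psi r * ?h)"
    by (simp add: transform_def linear_diff[OF linear_psi] algebra_simps)
  also have "psi r * ?h = \<kappa> *\<^sub>R ((norm (s x))\<^sup>2 *\<^sub>R (qcnj (p x) * (\<delta> * F (T x))))"
  proof -
    have "qcnj (p x) * (p x * (psi r * (s x * F (T x)))) = (norm (p x))\<^sup>2 *\<^sub>R (psi r * (s x * F (T x)))"
      using p_nz[OF x] by (simp add: qcnj_eq_inverse flip: mult.assoc)
    then show ?thesis
      using p_nz[OF x] s_nz[OF x]
      by (simp add: \<delta> C mult.assoc power_mult_distrib field_simps)
  qed
  finally show ?thesis
    by (simp add: algebra_simps)
qed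

text \<open>The hypothesis on $\rho$ says that $|C|^2 \rho$ is the Jacobian of $T$, and $\gamma$ compensates the
square of the exponential factor.\<close>

lemma integrable_transform_iff:
  assumes \<gamma>: "\<And>x. x \<in> \<Xi> \<Longrightarrow> \<gamma> (T x) = exp (2 * (m \<bullet> x))"
    and \<rho>: "\<And>x. x \<in> \<Xi> \<Longrightarrow> (norm (C x))\<^sup>2 * \<rho> x = (norm (p x) * norm (s x)) ^ 4"
  shows "set_integrable lebesgue \<Omega> (\<lambda>y. (norm (F y))\<^sup>2 * \<gamma> y) \<longleftrightarrow>
         set_integrable lebesgue \<Xi> (\<lambda>x. (norm (transform m F x))\<^sup>2 * \<rho> x)"
proof -
  have "inj_on T \<Xi>"
    by (rule inj_on_inverseI) (rule Tinv_T)
  then have "set_integrable lebesgue \<Omega> (\<lambda>y. (norm (F y))\<^sup>2 * \<gamma> y) \<longleftrightarrow>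
      set_integrable lebesgue \<Xi>
        (\<lambda>x. \<bar>det (matrix (sandwich (p x) (s x)))\<bar> * ((norm (F (T x)))\<^sup>2 * \<gamma> (T x)))"
    unfolding image_T[symmetric]
    using T_deriv open_\<Xi>
    by (intro integrable_change_of_variables_real_valued) (auto intro: has_derivative_at_withinI)
  also have "\<dots> \<longleftrightarrow> set_integrable lebesgue \<Xi> (\<lambda>x. (norm (transform m F x))\<^sup>2 * \<rho> x)"
  proof (rule set_integrable_cong[OF refl refl])
    fix x assume x: "x \<in> \<Xi>"
    have "(exp (m \<bullet> x))\<^sup>2 = exp (2 * (m \<bullet> x))"
      by (simp add: exp_double)
    then show "\<bar>det (matrix (sandwich (p x) (s x)))\<bar> * ((norm (F (T x)))\<^sup>2 * \<gamma> (T x))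
        = (norm (transform m F x))\<^sup>2 * \<rho> x"
      unfolding abs_det_sandwich[OF p_nz[OF x] s_nz[OF x]] \<rho>[OF x, symmetric] \<gamma>[OF x]
      by (simp add: transform_def norm_mult power_mult_distrib)
  qed
  finally show ?thesis .
qed

lemma dirac_solution_transform_iff:
  assumes \<gamma>: "\<And>x. x \<in> \<Xi> \<Longrightarrow> \<gamma> (T x) = exp (2 * ((r - q) \<bullet> x))"
    and \<rho>: "\<And>x. x \<in> \<Xi> \<Longrightarrow> (norm (C x))\<^sup>2 * \<rho> x = (norm (p x) * norm (s x)) ^ 4"
    and \<delta>: "\<And>x. x \<in> \<Xi> \<Longrightarrow> \<delta> (T x) = (p x * psi r * s x) /\<^sub>R (norm (p x) * norm (s x))\<^sup>2"
  shows "dirac_solution \<Omega> \<delta> \<gamma> F \<longleftrightarrow> dirac_solution \<Xi> (\<lambda>_. psi q) \<rho> (transform (r - q) F)"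
proof -
  have "(\<forall>y\<in>\<Omega>. dirac (frechet_derivative F (at y)) + \<delta> y * F y = 0) \<longleftrightarrow>
    (\<forall>x\<in>\<Xi>. dirac (frechet_derivative (transform (r - q) F) (at x))
              + psi q * transform (r - q) F x = 0)" if F: "C1_map \<Omega> F"
    unfolding image_T[symmetric] ball_simps
  proof (rule ball_cong[OF refl])
    fix x assume x: "x \<in> \<Xi>"
    obtain \<kappa> where \<kappa>: "\<kappa> \<noteq> 0" "C x = \<kappa> *\<^sub>R s x"
      using C_parallel[OF x] by blast
    show "dirac (frechet_derivative F (at (T x))) + \<delta> (T x) * F (T x) = 0 \<longleftrightarrow>
        dirac (frechet_derivative (transform (r - q) F) (at x)) + psi q * transform (r - q) F x = 0"
      unfolding dirac_transform[OF F x \<kappa>(2) \<delta>[OF x]]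
      using \<kappa>(1) p_nz[OF x] s_nz[OF x] by (simp add: qcnj_eq_inverse)
  qed
  then show ?thesis
    unfolding dirac_solution_def C1_map_transform_iff
    using integrable_transform_iff[OF \<gamma> \<rho>, of F] by blast
qed

end

section \<open>The Cauchy kernel\<close>

text \<open>This is $\overline{n} / |n|^4$; up to a constant it is the fundamental solution of the Dirac operator.\<close>

definition cauchy_kernel :: "quat \<Rightarrow> quat" where
  "cauchy_kernel n = inverse (n \<bullet> n) *\<^sub>R inverse n"

definition cauchy_kernel_deriv :: "quat \<Rightarrow> quat \<Rightarrow> quat" where
  "cauchy_kernel_deriv n h = inverse (n \<bullet> n) *\<^sub>R - (inverse n * h * inverse n)
     + - (inverse (n \<bullet> n) * (n \<bullet> h + h \<bullet> n) * inverse (n \<bullet> n)) *\<^sub>R inverse n"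

lemma has_derivative_cauchy_kernel:
  "n \<noteq> 0 \<Longrightarrow> (cauchy_kernel has_derivative cauchy_kernel_deriv n) (at n)"
  unfolding cauchy_kernel_def cauchy_kernel_deriv_def
  by (intro has_derivative_scaleR Deriv.has_derivative_inverse has_derivative_inner
      has_derivative_ident) auto

text \<open>Two contributions cancel: $\sum_k \psi_k\, n^{-1} \psi_k = -2\, \overline{n^{-1}}$ makes the derivative of
$n^{-1}$ contribute $2 |n|^{-4}$, and the derivative of $|n|^{-2}$ contributes $-2 |n|^{-4}$.\<close>

lemma dirac_cauchy_kernel:
  assumes "n \<noteq> 0"
  shows "dirac (\<lambda>v. cauchy_kernel_deriv n (psi v)) = 0"
proof -
  have *: "cauchy_kernel_deriv n (psi v)
      = - inverse (n \<bullet> n) *\<^sub>R (inverse n * psi v * inverse n)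
        + (- 2 * (inverse (n \<bullet> n))\<^sup>2) *\<^sub>R ((psi_inv n \<bullet> v) *\<^sub>R inverse n)" for v
    unfolding cauchy_kernel_deriv_def inner_commute[of "psi v" n] inner_psi
    by (simp add: power2_eq_square mult_ac)
  show ?thesis
    unfolding * dirac_add dirac_scaleR dirac_mult_right dirac_const_mult_psi dirac_inner psi_psi_inv
    using assms
    by (simp add: qcnj_eq_inverse power2_norm_eq_inner[symmetric] norm_inverse power2_eq_square)
qed

section \<open>Moebius transformations\<close>

locale moebius_equivalence =
  fixes a b c d :: quat and \<Xi> \<Omega> :: "(real ^ 4) set"
  assumes open_dom: "open \<Xi>" and open_img: "open \<Omega>" and maps: "moebius_maps a b c d \<Xi> \<Omega>"
begin

abbreviation "T \<equiv> moebius a b c d"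
abbreviation "V \<equiv> moebius_V a b c d"
abbreviation "denom x \<equiv> c * psi x + d"

text \<open>The left factor of the differential of $T$ at $x$, written as a function of $y = T(x)$: in this form it serves
both $c = 0$ and $c \neq 0$, and it also inverts $T$, since $y (cx + d) = ax + b$ is equivalent to
$(a - y c)\, x = y d - b$.\<close>

definition "left_factor y = a - psi y * c"
definition "Tinv y = psi_inv (inverse (left_factor y) * (psi y * d - b))"

lemma denom_nz: "x \<in> \<Xi> \<Longrightarrow> denom x \<noteq> 0"
  using maps by (simp add: moebius_maps_def)

lemma a_nz: "c = 0 \<Longrightarrow> a \<noteq> 0" and d_nz: "c = 0 \<Longrightarrow> d \<noteq> 0" and V_nz: "c \<noteq> 0 \<Longrightarrow> V \<noteq> 0"
  using maps by (auto simp: moebius_maps_def moebius_params_def)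

lemma image_T: "T ` \<Xi> = \<Omega>" and inj_T: "inj_on T \<Xi>"
  using maps by (auto simp: moebius_maps_def bij_betw_def)

lemma psi_T: "psi (T x) = (a * psi x + b) * inverse (denom x)"
  by (simp add: moebius_def psi_psi_inv)

text \<open>Splitting off the pole, $ax + b = a c^{-1} (cx + d) + V$.\<close>

lemma psi_T_pole:
  assumes "c \<noteq> 0" "x \<in> \<Xi>"
  shows "psi (T x) - a * inverse c = V * inverse (denom x)"
proof -
  have "inverse c * (c * psi x) = psi x"
    using assms(1) by (simp flip: mult.assoc)
  then have num: "a * psi x + b = a * inverse c * denom x + V"
    by (simp add: moebius_V_def distrib_left mult.assoc)
  have "(k * n + V) * inverse n = k + V * inverse n" if "n \<noteq> 0" for k n
    using that by (simp add: distrib_right mult.assoc)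
  from this[OF denom_nz[OF assms(2)]] show ?thesis
    unfolding psi_T num by simp
qed

lemma left_factor_T:
  assumes "c \<noteq> 0" "x \<in> \<Xi>"
  shows "left_factor (T x) = - (V * inverse (denom x) * c)"
  using assms(1) unfolding psi_T_pole[OF assms, symmetric]
  by (simp add: left_factor_def left_diff_distrib mult.assoc)

lemma left_factor_nz: "y \<in> \<Omega> \<Longrightarrow> left_factor y \<noteq> 0"
proof -
  have "left_factor (T x) \<noteq> 0" if "x \<in> \<Xi>" for x
  proof (cases "c = 0")
    case True
    then show ?thesis unfolding left_factor_def using a_nz by simp
  next
    case False
    then show ?thesis using left_factor_T[OF False that] denom_nz[OF that] V_nz by simp
  qed
  then show "y \<in> \<Omega> \<Longrightarrow> left_factor y \<noteq> 0"
    using image_T by blast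
qed

lemma Tinv_T:
  assumes x: "x \<in> \<Xi>"
  shows "Tinv (T x) = x"
proof -
  have "psi (T x) * denom x = a * psi x + b"
    using denom_nz[OF x] by (simp add: psi_T mult.assoc)
  then have "psi (T x) * d - b = left_factor (T x) * psi x"
    by (simp add: left_factor_def algebra_simps)
  moreover have "left_factor (T x) \<noteq> 0"
    using left_factor_nz image_T x by blast
  ultimately show ?thesis
    by (simp add: Tinv_def psi_inv_psi flip: mult.assoc)
qed

lemmas C1_map_psi = C1_map_bounded_linear[OF bounded_linear_psi]
lemmas C1_map_psi_inv = C1_map_linear[OF bounded_linear_psi_inv]

lemma C1_map_denom: "C1_map S denom"
  by (intro C1_map_add C1_map_mult C1_map_const C1_map_psi)

lemma C1_map_T: "C1_map \<Xi> T"
  unfolding moebius_def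
  by (intro C1_map_psi_inv C1_map_mult C1_map_add C1_map_const C1_map_psi C1_map_inverse
      C1_map_denom denom_nz)

lemma C1_map_Tinv: "C1_map \<Omega> Tinv"
proof -
  have "C1_map \<Omega> (\<lambda>y. a + - 1 * (psi y * c))"
    by (intro C1_map_add C1_map_mult C1_map_const C1_map_psi)
  then have "C1_map \<Omega> left_factor"
    by (simp add: left_factor_def[abs_def])
  moreover have "C1_map \<Omega> (\<lambda>y. psi y * d + - b)"
    by (intro C1_map_add C1_map_mult C1_map_const C1_map_psi)
  ultimately show ?thesis
    unfolding Tinv_def[abs_def]
    by (intro C1_map_psi_inv C1_map_mult C1_map_inverse left_factor_nz) simp_all
qed

lemma has_derivative_denom: "(denom has_derivative (\<lambda>v. c * psi v)) (at x)"
  using bounded_linear_imp_has_derivative[OF bounded_linear_psi]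
  by (auto intro!: derivative_eq_intros)

text \<open>Both terms of the quotient rule, $a\, v\, (cx + d)^{-1}$ and $-(ax + b)(cx + d)^{-1}\, c\, v\, (cx + d)^{-1}$, end in
the same right factor.\<close>

lemma has_derivative_T:
  assumes x: "x \<in> \<Xi>"
  shows "(T has_derivative sandwich (left_factor (T x)) (inverse (denom x))) (at x)"
proof -
  have "((\<lambda>x. psi_inv ((a * psi x + b) * inverse (denom x))) has_derivative
      (\<lambda>v. psi_inv ((a * psi x + b) * - (inverse (denom x) * (c * psi v) * inverse (denom x))
                      + (a * psi v + 0) * inverse (denom x)))) (at x)"
    by (intro bounded_linear.has_derivative[OF bounded_linear_psi_inv] has_derivative_mult
        has_derivative_add has_derivative_const Deriv.has_derivative_inverse has_derivative_denom
        has_derivative_mult_right bounded_linear_imp_has_derivative[OF bounded_linear_psi]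
        denom_nz[OF x])
  moreover have "(a * psi x + b) * - (inverse (denom x) * (c * psi v) * inverse (denom x))
        + (a * psi v + 0) * inverse (denom x) = left_factor (T x) * psi v * inverse (denom x)" for v
    by (simp add: left_factor_def psi_T left_diff_distrib mult.assoc)
  ultimately show ?thesis
    by (simp add: moebius_def[abs_def] sandwich_def[abs_def])
qed

text \<open>With $u = (cx + d) V^{-1}$ the conjugate is $\overline{u} = |u|^2\, V (cx + d)^{-1}$, so that the factor
$V^{-1}$ in \<open>C_T\<close> cancels.\<close>

lemma C_T_eq:
  assumes x: "x \<in> \<Xi>"
  shows "C_T a b c d x =
    (if c = 0 then ((norm a)\<^sup>2 / norm d) *\<^sub>R inverse d
     else ((norm c)\<^sup>2 * norm V) *\<^sub>R cauchy_kernel (denom x))"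
proof (cases "c = 0")
  case False
  let ?u = "c * psi x * inverse V + d * inverse V"
  note nz = denom_nz[OF x] V_nz[OF False]
  have u: "?u = denom x * inverse V"
    by (simp add: distrib_right)
  have nu: "norm ?u = norm (denom x) / norm V"
    by (simp add: u norm_mult norm_inverse divide_inverse)
  have "inverse V * qcnj ?u = (norm ?u)\<^sup>2 *\<^sub>R inverse (denom x)"
    using nz by (simp add: qcnj_eq_inverse u nonzero_inverse_mult_distrib flip: mult.assoc)
  then have "C_T a b c d x
      = ((norm c)\<^sup>2 / norm V * (inverse (norm ?u ^ 4) * (norm ?u)\<^sup>2)) *\<^sub>R inverse (denom x)"
    using False by (simp add: C_T_def Let_def)
  also have "(norm c)\<^sup>2 / norm V * (inverse (norm ?u ^ 4) * (norm ?u)\<^sup>2)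
      = (norm c)\<^sup>2 * norm V * inverse (denom x \<bullet> denom x)"
    unfolding nu using nz
    by (simp add: field_simps power2_eq_square power4_eq_xxxx flip: power2_norm_eq_inner)
  finally show ?thesis
    using False by (simp add: cauchy_kernel_def)
qed (simp add: C_T_def)

lemma C_T_parallel:
  assumes x: "x \<in> \<Xi>"
  shows "\<exists>\<kappa>. \<kappa> \<noteq> 0 \<and> C_T a b c d x = \<kappa> *\<^sub>R inverse (denom x)"
proof (cases "c = 0")
  case True
  then show ?thesis
    unfolding C_T_eq[OF x] using a_nz d_nz
    by (intro exI[of _ "(norm a)\<^sup>2 / norm d"]) simp
next
  case False
  then show ?thesis
    using V_nz denom_nz[OF x]
    by (intro exI[of _ "(norm c)\<^sup>2 * norm V * inverse (denom x \<bullet> denom x)"])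
       (simp add: C_T_eq[OF x] cauchy_kernel_def)
qed

lemma C1_map_C_T: "C1_map \<Xi> (C_T a b c d)"
proof -
  have "C1_map \<Xi> (\<lambda>x. k *\<^sub>R cauchy_kernel (denom x))" for k
    unfolding cauchy_kernel_def
    by (intro C1_map_const C1_map_scaleR C1_map_inverse C1_map_bilinear[OF bounded_bilinear_inner]
        C1_map_denom) (simp_all add: denom_nz)
  then have "C1_map \<Xi> (\<lambda>x. if c = 0 then ((norm a)\<^sup>2 / norm d) *\<^sub>R inverse d
     else ((norm c)\<^sup>2 * norm V) *\<^sub>R cauchy_kernel (denom x))"
    using C1_map_const by (cases "c = 0") (simp_all only: simp_thms if_True if_False)
  then show ?thesis
    by (subst C1_map_cong[OF open_dom C_T_eq])
qed

text \<open>For $c \neq 0$ the affine map $x \mapsto cx + d$ is a sandwich map with right factor $1$ up to translation,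
so \<open>dirac_sandwich\<close> reduces the claim to the Cauchy kernel itself.\<close>

lemma C_T_monogenic:
  assumes x: "x \<in> \<Xi>"
  shows "dirac (frechet_derivative (C_T a b c d) (at x)) = 0"
proof (cases "c = 0")
  case True
  have "((\<lambda>x. ((norm a)\<^sup>2 / norm d) *\<^sub>R inverse d) has_derivative (\<lambda>v. 0)) (at x)"
    by simp
  then have "(C_T a b c d has_derivative (\<lambda>v. 0)) (at x)"
    by (rule has_derivative_transform_within_open[OF _ open_dom x])
       (unfold C_T_eq, use True in simp)
  then show ?thesis
    by (simp add: dirac_def flip: frechet_derivative_at)
next
  case False
  let ?k = "(norm c)\<^sup>2 * norm V" and ?A = "\<lambda>v. cauchy_kernel_deriv (denom x) (psi v)"
  have "((\<lambda>x. ?k *\<^sub>R cauchy_kernel (denom x)) has_derivative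
      (\<lambda>v. ?k *\<^sub>R cauchy_kernel_deriv (denom x) (c * psi v))) (at x)"
    by (intro has_derivative_scaleR_right has_derivative_compose[OF has_derivative_denom]
        has_derivative_cauchy_kernel denom_nz[OF x])
  then have "((\<lambda>x. ?k *\<^sub>R cauchy_kernel (denom x)) has_derivative
      (\<lambda>v. ?k *\<^sub>R (1 * ?A (sandwich c 1 v)))) (at x)"
    by (simp add: sandwich_def psi_psi_inv)
  then have "(C_T a b c d has_derivative (\<lambda>v. ?k *\<^sub>R (1 * ?A (sandwich c 1 v)))) (at x)"
    by (rule has_derivative_transform_within_open[OF _ open_dom x]) (simp add: C_T_eq False)
  moreover have "linear ?A"
    using has_derivative_linear[OF has_derivative_cauchy_kernel[OF denom_nz[OF x]]]
    by (rule linear_compose[OF linear_psi, unfolded o_def])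
  ultimately show ?thesis
    using dirac_cauchy_kernel[OF denom_nz[OF x]] dirac_sandwich[of ?A 1 c]
    by (simp add: dirac_scaleR flip: frechet_derivative_at)
qed

sublocale conformal_intertwiner \<Xi> \<Omega> T Tinv "\<lambda>x. left_factor (T x)" "\<lambda>x. inverse (denom x)" "C_T a b c d"
proof
  show "open \<Xi>" "open \<Omega>" "T ` \<Xi> = \<Omega>"
    by (fact open_dom open_img image_T)+
qed (auto simp: Tinv_T C1_map_T C1_map_Tinv C1_map_C_T has_derivative_T C_T_parallel C_T_monogenic
       denom_nz left_factor_nz image_T[THEN equalityD1, THEN subsetD, OF imageI])

lemma norm_left_factor_T:
  assumes "c \<noteq> 0" "x \<in> \<Xi>"
  shows "norm (left_factor (T x)) = norm V * norm c / norm (denom x)"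
  by (simp add: left_factor_T[OF assms] norm_mult norm_inverse divide_inverse mult_ac)

lemma gamma_T_T: "x \<in> \<Xi> \<Longrightarrow> gamma_T a b c d \<Xi> r q (T x) = exp (2 * ((r - q) \<bullet> x))"
  by (simp add: gamma_T_def the_inv_into_f_f[OF inj_T])

text \<open>Both sides are the Jacobian of $T$; for $c \neq 0$ they equal $(|V|\,|c| / |cx + d|^2)^4$.\<close>

lemma norm_C_T_rho_T:
  assumes x: "x \<in> \<Xi>"
  shows "(norm (C_T a b c d x))\<^sup>2 * rho_T a b c d x = (norm (left_factor (T x)) * norm (inverse (denom x))) ^ 4"
proof (cases "c = 0")
  case True
  then show ?thesis
    unfolding C_T_eq[OF x] left_factor_def rho_T_def
    by (simp add: norm_inverse divide_inverse power_mult_distrib eval_nat_numeral mult_ac)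
next
  case False
  let ?n = "norm (denom x)"
  have "norm (c * psi x * inverse V + d * inverse V) = ?n / norm V"
    by (simp add: norm_mult norm_inverse divide_inverse flip: distrib_right)
  then have rho: "rho_T a b c d x = (norm V / ?n)\<^sup>2"
    using False by (simp add: rho_T_def Let_def power_divide)
  have C: "norm (C_T a b c d x) = (norm c)\<^sup>2 * norm V / ?n ^ 3"
    using False
    by (simp add: C_T_eq[OF x] cauchy_kernel_def norm_inverse divide_inverse eval_nat_numeral mult_ac
        flip: power2_norm_eq_inner)
  show ?thesis
    unfolding rho C norm_left_factor_T[OF False x] norm_inverse
    using denom_nz[OF x] by (simp add: field_simps eval_nat_numeral)
qed

text \<open>For $c \neq 0$ put $z = y - a c^{-1} = V (cx + d)^{-1}$; then $-z c$ is the left factor of the differential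
and $\overline{V} z = |V|^2 (cx + d)^{-1}$ is a multiple of the right one.\<close>

lemma delta_T_T:
  assumes x: "x \<in> \<Xi>"
  shows "delta_T a b c d r (T x)
    = (left_factor (T x) * psi r * inverse (denom x)) /\<^sub>R (norm (left_factor (T x)) * norm (inverse (denom x)))\<^sup>2"
proof (cases "c = 0")
  case True
  have "inverse (qcnj a) = inverse ((norm a)\<^sup>2) *\<^sub>R a"
    using a_nz[OF True] by (simp add: qcnj_eq_inverse nonzero_inverse_scaleR_distrib)
  then show ?thesis
    unfolding delta_T_def left_factor_def
    using True by (simp add: qcnj_eq_inverse norm_inverse power_mult_distrib power_inverse)
next
  case False
  let ?n = "denom x"
  let ?z = "V * inverse ?n"
  note nz = denom_nz[OF x] V_nz[OF False]
  have "qcnj V * ?z = (norm V)\<^sup>2 *\<^sub>R inverse ?n"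
    using nz by (simp add: qcnj_eq_inverse flip: mult.assoc)
  then have "- ((?z * c * psi r * qcnj V * ?z) /\<^sub>R ((norm c)\<^sup>2 * norm ?z ^ 4))
      = (inverse ((norm c)\<^sup>2 * norm ?z ^ 4) * (norm V)\<^sup>2) *\<^sub>R (- (?z * c) * psi r * inverse ?n)"
    by (simp add: mult.assoc)
  also have "inverse ((norm c)\<^sup>2 * norm ?z ^ 4) * (norm V)\<^sup>2
      = inverse ((norm (left_factor (T x)) * norm (inverse ?n))\<^sup>2)"
    unfolding norm_left_factor_T[OF False x] norm_mult norm_inverse
    using nz False by (simp add: field_simps eval_nat_numeral)
  finally show ?thesis
    using False by (simp add: delta_T_def Let_def psi_T_pole[OF False x] left_factor_T[OF False x])
qed

lemma gamma_T_continuous: "continuous_on \<Omega> (gamma_T a b c d \<Xi> r q)"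
proof (rule continuous_on_eq)
  show "continuous_on \<Omega> (\<lambda>y. exp (2 * ((r - q) \<bullet> Tinv y)))"
    by (intro continuous_intros C1_map_continuous_on C1_map_Tinv)
  show "exp (2 * ((r - q) \<bullet> Tinv y)) = gamma_T a b c d \<Xi> r q y" if "y \<in> \<Omega>" for y
    using gamma_T_T[OF Tinv_in[OF that]] by (simp add: T_Tinv[OF that])
qed

lemma rho_T_continuous: "continuous_on \<Xi> (rho_T a b c d)"
proof (cases "c = 0")
  case False
  have "c * psi x * inverse V + d * inverse V \<noteq> 0" if "x \<in> \<Xi>" for x
    using denom_nz[OF that] V_nz[OF False] by (simp flip: distrib_right)
  then show ?thesis
    unfolding rho_T_def Let_def using False
    by (auto intro!: continuous_intros bounded_linear.continuous_on[OF bounded_linear_psi])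
qed (simp add: rho_T_def[abs_def])

text \<open>The four bracketed sums in the operator are the components of the quaternion product $C_T(x)\, F(T(x))$.\<close>

lemma cimmino_operator_eq:
  "cimmino_operator a b c d \<Xi> r q f = tuple_on \<Xi> (transform (r - q) (quat_field f))"
  by (cases f) (simp add: cimmino_operator_def tuple_on_def transform_def quat_field_def
      quat_mult_sel Let_def algebra_simps)

end

section \<open>The Cimmino operator\<close>

theorem proposition3p8:
  fixes q r :: "real ^ 4" and a b c d :: quat and \<Omega> \<Xi> :: "(real ^ 4) set"
  assumes "domain4 \<Omega>" and "domain4 \<Xi>" and "moebius_maps a b c d \<Xi> \<Omega>"
  shows "(\<forall>f \<in> four_tuples \<Omega>.
            f \<in> CB \<Omega> (delta_T a b c d r) (gamma_T a b c d \<Xi> r q) \<longleftrightarrow>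
            cimmino_operator a b c d \<Xi> r q f \<in> CB \<Xi> (\<lambda>_. psi q) (rho_T a b c d)) \<and>
         bij_betw (cimmino_operator a b c d \<Xi> r q)
           (CB \<Omega> (delta_T a b c d r) (gamma_T a b c d \<Xi> r q))
           (CB \<Xi> (\<lambda>_. psi q) (rho_T a b c d)) \<and>
         real_linear_operator
           \<Omega> (CB \<Omega> (delta_T a b c d r) (gamma_T a b c d \<Xi> r q))
           \<Xi> (CB \<Xi> (\<lambda>_. psi q) (rho_T a b c d))
           (cimmino_operator a b c d \<Xi> r q)"
proof -
  interpret moebius_equivalence a b c d \<Xi> \<Omega>
    using assms by unfold_locales (auto simp: domain4_def)
  let ?m = "r - q" and ?L = "cimmino_operator a b c d \<Xi> r q"
  let ?X = "CB \<Omega> (delta_T a b c d r) (gamma_T a b c d \<Xi> r q)"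
  let ?Y = "CB \<Xi> (\<lambda>_. psi q) (rho_T a b c d)"
  have \<gamma>: "continuous_on \<Omega> (gamma_T a b c d \<Xi> r q)" "\<forall>y\<in>\<Omega>. 0 \<le> gamma_T a b c d \<Xi> r q y"
    by (rule gamma_T_continuous) (simp add: gamma_T_def)
  have \<rho>: "continuous_on \<Xi> (rho_T a b c d)" "\<forall>x\<in>\<Xi>. 0 \<le> rho_T a b c d x"
    by (rule rho_T_continuous) (simp add: rho_T_def Let_def)
  have iff: "f \<in> ?X \<longleftrightarrow> ?L f \<in> ?Y" if "f \<in> four_tuples \<Omega>" for f
    unfolding CB_iff_dirac_solution[OF open_img \<gamma> that] cimmino_operator_eq
      tuple_on_mem_CB[OF open_dom \<rho>]
    by (intro dirac_solution_transform_iff gamma_T_T norm_C_T_rho_T delta_T_T)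
  \<comment> \<open>The inverse operator; it divides by $C_T$ from the left, the side on which $C_T$ multiplies $F$.\<close>
  define R where "R g = tuple_on \<Omega> (untransform ?m (quat_field g))" for g
  have LR: "?L (R g) = g" if "g \<in> four_tuples \<Xi>" for g
  proof -
    have "?L (R g) = tuple_on \<Xi> (transform ?m (untransform ?m (quat_field g)))"
      unfolding cimmino_operator_eq R_def
      by (rule tuple_on_cong) (simp add: transform_def quat_field_tuple_on T_in)
    also have "\<dots> = tuple_on \<Xi> (quat_field g)"
      by (rule tuple_on_cong) (rule transform_untransform)
    finally show ?thesis by (simp add: tuple_on_quat_field that)
  qed
  have RL: "R (?L f) = f" if "f \<in> four_tuples \<Omega>" for f
  proof -
    have "R (?L f) = tuple_on \<Omega> (untransform ?m (transform ?m (quat_field f)))"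
      unfolding cimmino_operator_eq R_def
      by (rule tuple_on_cong) (simp add: untransform_def quat_field_tuple_on Tinv_in)
    also have "\<dots> = tuple_on \<Omega> (quat_field f)"
      by (rule tuple_on_cong) (rule untransform_transform)
    finally show ?thesis by (simp add: tuple_on_quat_field that)
  qed
  have R_in: "R g \<in> four_tuples \<Omega>" for g
    by (simp add: R_def tuple_on_four_tuples)
  have sub: "?X \<subseteq> four_tuples \<Omega>" "?Y \<subseteq> four_tuples \<Xi>"
    by (rule CB_subset_four_tuples)+
  have L_in: "?L \<in> ?X \<rightarrow> ?Y"
    using iff sub(1) by blast
  have bij: "bij_betw ?L ?X ?Y"
  proof (rule bij_betwI[where g = R])
    show "?L \<in> ?X \<rightarrow> ?Y"
      by (rule L_in)
    show "R \<in> ?Y \<rightarrow> ?X"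
    proof
      fix g assume "g \<in> ?Y"
      moreover from this have "?L (R g) = g"
        by (intro LR subsetD[OF sub(2)])
      ultimately show "R g \<in> ?X"
        by (simp add: iff[OF R_in])
    qed
  qed (auto intro!: LR RL subsetD[OF sub(1)] subsetD[OF sub(2)])
  have "?L (add4 \<Omega> f h) = add4 \<Xi> (?L f) (?L h)" for f h
    unfolding cimmino_operator_eq add4_eq
    by (rule tuple_on_cong) (simp add: transform_def quat_field_tuple_on T_in algebra_simps)
  moreover have "?L (scale4 \<Omega> t f) = scale4 \<Xi> t (?L f)" for t f
    unfolding cimmino_operator_eq scale4_eq
    by (rule tuple_on_cong) (simp add: transform_def quat_field_tuple_on T_in)
  ultimately have "real_linear_operator \<Omega> ?X \<Xi> ?Y ?L"
    using real_function_space_CB[OF open_img \<gamma>] real_function_space_CB[OF open_dom \<rho>] L_in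
    by (simp add: real_linear_operator_def)
  with bij iff show ?thesis
    by simp
qed

end
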